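(* Let $G$ be a principally directed ordered groupoid. Then the functor $\operatorname{colim}^{E(G)} : \operatorname{Mod}_{G} \to \operatorname{Mod}_{G/\beta}$ is left adjoint to the expansion functor $\operatorname{Mod}_{G/\beta} \to \operatorname{Mod}_{G}$, $\mathcal{B} \mapsto \mathcal{B}^{\uparrow}_{\beta}$.
   Context: A groupoid $G$ is a small category in which every morphism is invertible, regarded as the set of its morphisms with a partial composition; $E(G)$ is its set of identities. For $g\in G$, write $g\mathbf{d}=gg^{-1}$ (domain identity) and $g\mathbf{r}=g^{-1}g$ (range identity); composition is written left to right, so $gh$ is defined iff $g\mathbf{r}=h\mathbf{d}$. Maps are written on the right of their arguments. An ordered groupoid is a groupoid $G$ with a partial order $\leqslant$ such that: (OG1) $x\leqslant y \Rightarrow x^{-1}\leqslant y^{-1}$; (OG2) if $x\leqslant y$ and $u\leqslant v$ then $xu\leqslant yv$ whenever $xu$ and $yv$ are defined; (OG3) if $e\in E(G)$ and $e\leqslant x\mathbf{d}$, there is a unique element $(e|x)$ (restriction) with $(e|x)\mathbf{d}=e$ and $(e|x)\leqslant x$; (OG4) if $e\in E(G)$ and $e\leqslant x\mathbf{r}$, there is a unique element $(x|e)$ (corestriction) with $(x|e)\mathbf{r}=e$ and $(x|e)\leqslant x$. The relation $\beta$ on $G$: $g\,\beta\,h$ iff there is $k\in G$ with $k\leqslant g$ and $k\leqslant h$. $G$ is principally directed if every principal order ideal $\{g\in G: g\leqslant t\}$, $t \in G$, is a directed set (any two of its elements have a common lower bound in it); equivalently, $\beta$ is transitive. Then the set $G/\beta$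 of $\beta$-classes $g\beta$ is a groupoid, with composition $(g\beta)(h\beta)=[(g|f)(f|h)]\beta$ defined when $g^{-1}g\,\beta\,hh^{-1}$, where $f\in E(G)$ is any common lower bound of $g^{-1}g$ and $hh^{-1}$; its identities are the classes $e\beta$, $e\in E(G)$. $G/\beta$ is regarded as trivially ordered. The category $\mathfrak{L}(G)$ has object set $E(G)$ and morphisms the pairs $(e,g)\in E(G)\times G$ with $g\mathbf{d}\leqslant e$; $(e,g)$ goes from $e$ to $g\mathbf{r}$, and $(e,g)(f,h)=(e,(g|h\mathbf{d})h)$ when $g\mathbf{r}=f$. A $G$-module is a functor $\mathcal{A}$ from $\mathfrak{L}(G)$ to abelian groups: abelian groups $A_e$ ($e\in E(G)$) and homomorphisms $\alpha_{(e,g)}:A_e\to A_{g^{-1}g}$; write $a\lhd(e,g)=a\alpha_{(e,g)}$, and $a \lhd g$ for $a\lhd(g\mathbf{d},g)$. $G$-maps are natural transformations, and $\operatorname{Mod}_G=\operatorname{Mod}_{\mathfrak{L}(G)}$ is the resulting category. Since $G/\beta$ is trivially ordered, $\mathfrak{L}(G/\beta)=G/\beta$, and a $G/\beta$-module is a functor from $G/\beta$ to abelian groups. Expansion functor: for a $G/\beta$-module $\mathcal{B}$, $\mathcal{B}^{\uparrow}_{\beta}$ is the $G$-module with $(\mathcal{B}^{\uparrow}_{\beta})_e=B_{e\beta}$, in which $(e,g)$ acts as $g\beta$ acts on $\mathcal{B}$, i.e. as $B_{e\beta}=B_{(gg^{-1})\beta}\to B_{(g^{-1}g)\beta}$ (in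 particular $(e,f)$ with $f\leqslant e$ in $E(G)$ acts as the identity). For a $G/\beta$-map $\xi$, $(\xi^{\uparrow}_{\beta})_e=\xi_{e\beta}$. The functor $\operatorname{colim}^{E(G)}$: given a $G$-module $\mathcal{A}$, restrict it to the poset $E(G)$, using only the maps $\alpha_{(e,f)}:A_e\to A_f$ for $f\leqslant e$. The colimit of this restricted diagram of abelian groups is a direct sum $\bigoplus_{x\in E(G)/\beta}L_x$, where $L_x$ is the colimit over the $\beta$-class $x$; let $\alpha_e:A_e\to L_{e\beta}$ be the canonical maps. The family $(L_x)$ is regarded as a $G/\beta$-module, still denoted $\operatorname{colim}^{E(G)}\mathcal{A}$, with action as follows: if $\overline{a}=a\alpha_e\in L_{e\beta}$ with $a\in A_e$, and $g\in G$ with $gg^{-1}\,\beta\,e$, choose a common lower bound $\ell\in E(G)$ of $gg^{-1}$ and $e$, and set $\overline{a}\lhd g\beta=(a\alpha_{(e,\ell)}\lhd(\ell|g))\alpha_z\in L_{(g^{-1}g)\beta}$, where $z=(\ell|g)\mathbf{r}$ (this is well defined). On $G$-maps the functor is given by the induced maps of colimits. *)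

theory Defs
  imports "HOL-Algebra.Product_Groups"
begin

section \<open>Categories, functors to abelian groups, natural transformations\<close>

text \<open>
  Composition is written in diagrammatic order: \<open>cmp C g h\<close> is "first \<open>g\<close>, then \<open>h\<close>",
  and is meaningful only if \<open>tgt C g = src C h\<close>.
\<close>

record ('o, 'm) cat =
  obj :: "'o set"
  arr :: "'m set"
  src :: "'m \<Rightarrow> 'o"
  tgt :: "'m \<Rightarrow> 'o"
  idn :: "'o \<Rightarrow> 'm"
  cmp :: "'m \<Rightarrow> 'm \<Rightarrow> 'm"

locale category =
  fixes C :: "('o, 'm, 'z) cat_scheme"
  assumes src_obj: "g \<in> arr C \<Longrightarrow> src C g \<in> obj C"
    and tgt_obj: "g \<in> arr C \<Longrightarrow> tgt C g \<in> obj C"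
    and idn_arr: "x \<in> obj C \<Longrightarrow> idn C x \<in> arr C"
    and src_idn: "x \<in> obj C \<Longrightarrow> src C (idn C x) = x"
    and tgt_idn: "x \<in> obj C \<Longrightarrow> tgt C (idn C x) = x"
    and cmp_arr: "\<lbrakk>g \<in> arr C; h \<in> arr C; tgt C g = src C h\<rbrakk> \<Longrightarrow> cmp C g h \<in> arr C"
    and src_cmp: "\<lbrakk>g \<in> arr C; h \<in> arr C; tgt C g = src C h\<rbrakk> \<Longrightarrow> src C (cmp C g h) = src C g"
    and tgt_cmp: "\<lbrakk>g \<in> arr C; h \<in> arr C; tgt C g = src C h\<rbrakk> \<Longrightarrow> tgt C (cmp C g h) = tgt C h"
    and cmp_assoc: "\<lbrakk>g \<in> arr C; h \<in> arr C; k \<in> arr C; tgt C g = src C h; tgt C h = src C k\<rbrakk>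
      \<Longrightarrow> cmp C (cmp C g h) k = cmp C g (cmp C h k)"
    and cmp_idn_left: "g \<in> arr C \<Longrightarrow> cmp C (idn C (src C g)) g = g"
    and cmp_idn_right: "g \<in> arr C \<Longrightarrow> cmp C g (idn C (tgt C g)) = g"

text \<open>
  An abelian group is a \<open>comm_group\<close> of HOL-Algebra, hence written multiplicatively. All groups
  of one functor share the carrier type \<open>'a\<close>; different functors may have different ones.
\<close>

record ('o, 'm, 'a) ab_functor =
  grp :: "'o \<Rightarrow> 'a monoid"
  act :: "'m \<Rightarrow> 'a \<Rightarrow> 'a"

definition is_ab_functor :: "('o, 'm, 'z) cat_scheme \<Rightarrow> ('o, 'm, 'a) ab_functor \<Rightarrow> bool" where
  "is_ab_functor C A \<longleftrightarrow>
     (\<forall>x\<in>obj C. comm_group (grp A x)) \<and>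
     (\<forall>g\<in>arr C. act A g \<in> hom (grp A (src C g)) (grp A (tgt C g))) \<and>
     (\<forall>x\<in>obj C. \<forall>a\<in>carrier (grp A x). act A (idn C x) a = a) \<and>
     (\<forall>g\<in>arr C. \<forall>h\<in>arr C. tgt C g = src C h \<longrightarrow>
        (\<forall>a\<in>carrier (grp A (src C g)). act A (cmp C g h) a = act A h (act A g a)))"

text \<open>
  The components of a natural transformation are required to be \<open>undefined\<close> outside the objects
  and the carriers, so that equality in \<open>nat_trans C A B\<close> is equality of natural transformations.
\<close>

definition nat_trans :: "('o, 'm, 'z) cat_scheme \<Rightarrow> ('o, 'm, 'a) ab_functor \<Rightarrow>
    ('o, 'm, 'b) ab_functor \<Rightarrow> ('o \<Rightarrow> 'a \<Rightarrow> 'b) set" where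
  "nat_trans C A B =
     {\<eta> \<in> \<Pi>\<^sub>E x\<in>obj C. hom (grp A x) (grp B x) \<inter> extensional (carrier (grp A x)).
        \<forall>g\<in>arr C. \<forall>a\<in>carrier (grp A (src C g)).
          \<eta> (tgt C g) (act A g a) = act B g (\<eta> (src C g) a)}"

definition nt_id :: "('o, 'm, 'z) cat_scheme \<Rightarrow> ('o, 'm, 'a) ab_functor \<Rightarrow> 'o \<Rightarrow> 'a \<Rightarrow> 'a" where
  "nt_id C A = (\<lambda>x\<in>obj C. \<lambda>a\<in>carrier (grp A x). a)"

text \<open>\<open>nt_comp C A \<eta> \<theta>\<close> is first \<open>\<eta>\<close>, then \<open>\<theta>\<close>; \<open>A\<close> is the domain of \<open>\<eta>\<close>.\<close>

definition nt_comp :: "('o, 'm, 'z) cat_scheme \<Rightarrow> ('o, 'm, 'a) ab_functor \<Rightarrow>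
    ('o \<Rightarrow> 'a \<Rightarrow> 'b) \<Rightarrow> ('o \<Rightarrow> 'b \<Rightarrow> 'c) \<Rightarrow> 'o \<Rightarrow> 'a \<Rightarrow> 'c" where
  "nt_comp C A \<eta> \<theta> = (\<lambda>x\<in>obj C. \<lambda>a\<in>carrier (grp A x). \<theta> x (\<eta> x a))"


section \<open>Ordered groupoids\<close>

text \<open>
  A groupoid is presented as the set of its morphisms: its objects are its identities, so \<open>obj\<close>
  is \<open>E(G)\<close>, and \<open>src\<close>, \<open>tgt\<close> are the maps \<open>g \<mapsto> gg\<^sup>-\<^sup>1\<close>, \<open>g \<mapsto> g\<^sup>-\<^sup>1g\<close> into the set of identities.
\<close>

locale groupoid = category G for G :: "('g, 'g, 'z) cat_scheme" +
  assumes idn_self: "e \<in> obj G \<Longrightarrow> idn G e = e"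
    and invertible: "g \<in> arr G \<Longrightarrow>
      \<exists>h\<in>arr G. src G h = tgt G g \<and> tgt G h = src G g \<and> cmp G g h = src G g \<and> cmp G h g = tgt G g"

definition ginv :: "('g, 'g, 'z) cat_scheme \<Rightarrow> 'g \<Rightarrow> 'g" where
  "ginv G g = (THE h. h \<in> arr G \<and> src G h = tgt G g \<and> tgt G h = src G g \<and>
     cmp G g h = src G g \<and> cmp G h g = tgt G g)"

record 'g ord_gpd = "('g, 'g) cat" +
  le :: "'g \<Rightarrow> 'g \<Rightarrow> bool"

locale ordered_groupoid = groupoid G for G :: "'g ord_gpd" +
  assumes le_refl: "x \<in> arr G \<Longrightarrow> le G x x"
    and le_antisym: "\<lbrakk>x \<in> arr G; y \<in> arr G; le G x y; le G y x\<rbrakk> \<Longrightarrow> x = y"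
    and le_trans: "\<lbrakk>x \<in> arr G; y \<in> arr G; z \<in> arr G; le G x y; le G y z\<rbrakk> \<Longrightarrow> le G x z"
    and OG1: "\<lbrakk>x \<in> arr G; y \<in> arr G; le G x y\<rbrakk> \<Longrightarrow> le G (ginv G x) (ginv G y)"
    and OG2: "\<lbrakk>x \<in> arr G; y \<in> arr G; u \<in> arr G; v \<in> arr G; le G x y; le G u v;
      tgt G x = src G u; tgt G y = src G v\<rbrakk> \<Longrightarrow> le G (cmp G x u) (cmp G y v)"
    and OG3: "\<lbrakk>x \<in> arr G; e \<in> obj G; le G e (src G x)\<rbrakk>
      \<Longrightarrow> \<exists>!z. z \<in> arr G \<and> src G z = e \<and> le G z x"
    and OG4: "\<lbrakk>x \<in> arr G; e \<in> obj G; le G e (tgt G x)\<rbrakk>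
      \<Longrightarrow> \<exists>!z. z \<in> arr G \<and> tgt G z = e \<and> le G z x"

text \<open>\<open>restr G e x\<close> is \<open>(e|x)\<close> and \<open>corestr G x e\<close> is \<open>(x|e)\<close>.\<close>

definition restr :: "'g ord_gpd \<Rightarrow> 'g \<Rightarrow> 'g \<Rightarrow> 'g" where
  "restr G e x = (THE z. z \<in> arr G \<and> src G z = e \<and> le G z x)"

definition corestr :: "'g ord_gpd \<Rightarrow> 'g \<Rightarrow> 'g \<Rightarrow> 'g" where
  "corestr G x e = (THE z. z \<in> arr G \<and> tgt G z = e \<and> le G z x)"

locale principally_directed_ordered_groupoid = ordered_groupoid +
  assumes principally_directed:
    "\<lbrakk>t \<in> arr G; x \<in> arr G; y \<in> arr G; le G x t; le G y t\<rbrakk>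
      \<Longrightarrow> \<exists>z\<in>arr G. le G z t \<and> le G z x \<and> le G z y"


section \<open>The quotient by \<open>\<beta>\<close>\<close>

definition beta :: "'g ord_gpd \<Rightarrow> ('g \<times> 'g) set" where
  "beta G = {(g, h). g \<in> arr G \<and> h \<in> arr G \<and> (\<exists>k\<in>arr G. le G k g \<and> le G k h)}"

abbreviation beta_class :: "'g ord_gpd \<Rightarrow> 'g \<Rightarrow> 'g set" where
  "beta_class G g \<equiv> beta G `` {g}"

text \<open>
  Domain, range and composition are given by the image under \<open>\<beta>\<close> of the set of all values
  obtained from representatives; for principally directed \<open>G\<close> these values form part of a single
  \<open>\<beta>\<close>-class, so the image is that class. No order is recorded: \<open>G/\<beta>\<close> is trivially ordered, so
  that \<open>LL(G/\<beta>) = G/\<beta>\<close>, and \<open>G/\<beta>\<close>-modules are functors on the category \<open>quot G\<close> itself.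
\<close>

definition quot :: "'g ord_gpd \<Rightarrow> ('g set, 'g set) cat" where
  "quot G =
     \<lparr>obj = beta_class G ` obj G,
      arr = arr G // beta G,
      src = (\<lambda>p. beta G `` (src G ` p)),
      tgt = (\<lambda>p. beta G `` (tgt G ` p)),
      idn = (\<lambda>x. x),
      cmp = (\<lambda>p q. beta G `` {cmp G (corestr G g f) (restr G f h) | g f h.
                g \<in> p \<and> h \<in> q \<and> f \<in> obj G \<and> le G f (tgt G g) \<and> le G f (src G h)})\<rparr>"


section \<open>Modules\<close>

definition LL :: "'g ord_gpd \<Rightarrow> ('g, 'g \<times> 'g) cat" where
  "LL G =
     \<lparr>obj = obj G,
      arr = {(e, g). e \<in> obj G \<and> g \<in> arr G \<and> le G (src G g) e},
      src = fst,
      tgt = (\<lambda>(e, g). tgt G g),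
      idn = (\<lambda>e. (e, e)),
      cmp = (\<lambda>(e, g) (f, h). (e, cmp G (corestr G g (src G h)) h))\<rparr>"

type_synonym ('g, 'a) gmodule = "('g, 'g \<times> 'g, 'a) ab_functor"
type_synonym ('g, 'a) qmodule = "('g set, 'g set, 'a) ab_functor"

abbreviation G_module :: "'g ord_gpd \<Rightarrow> ('g, 'a) gmodule \<Rightarrow> bool" where
  "G_module G \<equiv> is_ab_functor (LL G)"

abbreviation G_maps ::
    "'g ord_gpd \<Rightarrow> ('g, 'a) gmodule \<Rightarrow> ('g, 'b) gmodule \<Rightarrow> ('g \<Rightarrow> 'a \<Rightarrow> 'b) set" where
  "G_maps G \<equiv> nat_trans (LL G)"

abbreviation quot_module :: "'g ord_gpd \<Rightarrow> ('g, 'a) qmodule \<Rightarrow> bool" where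
  "quot_module G \<equiv> is_ab_functor (quot G)"

abbreviation quot_maps ::
    "'g ord_gpd \<Rightarrow> ('g, 'a) qmodule \<Rightarrow> ('g, 'b) qmodule \<Rightarrow> ('g set \<Rightarrow> 'a \<Rightarrow> 'b) set" where
  "quot_maps G \<equiv> nat_trans (quot G)"


section \<open>The expansion functor\<close>

definition expand :: "'g ord_gpd \<Rightarrow> ('g, 'b) qmodule \<Rightarrow> ('g, 'b) gmodule" where
  "expand G B = \<lparr>grp = (\<lambda>e. grp B (beta_class G e)), act = (\<lambda>(e, g). act B (beta_class G g))\<rparr>"

definition expand_map :: "'g ord_gpd \<Rightarrow> ('g set \<Rightarrow> 'b \<Rightarrow> 'c) \<Rightarrow> 'g \<Rightarrow> 'b \<Rightarrow> 'c" where
  "expand_map G \<xi> = (\<lambda>e\<in>obj G. \<xi> (beta_class G e))"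


section \<open>The functor \<open>colim\<close>\<close>

text \<open>
  For a class \<open>x\<close> (an object of \<open>quot G\<close>) the colimit \<open>L\<^sub>x\<close> over the poset of identities in \<open>x\<close> is
  the usual colimit of abelian groups: the direct sum of the groups \<open>A\<^sub>e\<close> modulo the subgroup
  generated by the differences between \<open>a\<close> in \<open>A\<^sub>e\<close> and its image in \<open>A\<^sub>f\<close>, for \<open>f \<le> e\<close>.
\<close>

definition class_sum :: "'g ord_gpd \<Rightarrow> ('g, 'a) gmodule \<Rightarrow> 'g set \<Rightarrow> ('g \<Rightarrow> 'a) monoid" where
  "class_sum G A x = sum_group (x \<inter> obj G) (grp A)"

definition class_inj :: "'g ord_gpd \<Rightarrow> ('g, 'a) gmodule \<Rightarrow> 'g set \<Rightarrow> 'g \<Rightarrow> 'a \<Rightarrow> 'g \<Rightarrow> 'a" where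
  "class_inj G A x e a = (\<lambda>i\<in>x \<inter> obj G. if i = e then a else \<one>\<^bsub>grp A i\<^esub>)"

definition colim_rel :: "'g ord_gpd \<Rightarrow> ('g, 'a) gmodule \<Rightarrow> 'g set \<Rightarrow> ('g \<Rightarrow> 'a) set" where
  "colim_rel G A x = generate (class_sum G A x)
     {class_inj G A x e a \<otimes>\<^bsub>class_sum G A x\<^esub>
        inv\<^bsub>class_sum G A x\<^esub> (class_inj G A x f (act A (e, f) a)) | e f a.
      e \<in> x \<inter> obj G \<and> f \<in> x \<inter> obj G \<and> le G f e \<and> a \<in> carrier (grp A e)}"

definition colim_grp :: "'g ord_gpd \<Rightarrow> ('g, 'a) gmodule \<Rightarrow> 'g set \<Rightarrow> ('g \<Rightarrow> 'a) set monoid" where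
  "colim_grp G A x = class_sum G A x Mod colim_rel G A x"

text \<open>\<open>colim_can G A e\<close> is the canonical map \<open>\<alpha>\<^sub>e\<close> from \<open>A\<^sub>e\<close> to \<open>L\<^sub>x\<close> for the class \<open>x\<close> of \<open>e\<close>.\<close>

definition colim_can :: "'g ord_gpd \<Rightarrow> ('g, 'a) gmodule \<Rightarrow> 'g \<Rightarrow> 'a \<Rightarrow> ('g \<Rightarrow> 'a) set" where
  "colim_can G A e a =
     colim_rel G A (beta_class G e) #>\<^bsub>class_sum G A (beta_class G e)\<^esub>
       class_inj G A (beta_class G e) e a"

text \<open>
  The action of a class \<open>q\<close>: every element of the colimit over the domain of \<open>q\<close> is some
  \<open>a \<alpha>\<^sub>e\<close>, and the result does not depend on the choice of \<open>e\<close>, \<open>a\<close>, of the representative \<open>g\<close>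
  of \<open>q\<close>, and of the common lower bound \<open>l\<close> of \<open>gg\<^sup>-\<^sup>1\<close> and \<open>e\<close>.
\<close>

definition colim :: "'g ord_gpd \<Rightarrow> ('g, 'a) gmodule \<Rightarrow> ('g, ('g \<Rightarrow> 'a) set) qmodule" where
  "colim G A =
     \<lparr>grp = colim_grp G A,
      act = (\<lambda>q y. THE z. \<exists>g e a l. g \<in> q \<and> e \<in> obj G \<and> a \<in> carrier (grp A e) \<and>
               y = colim_can G A e a \<and> l \<in> obj G \<and> le G l (src G g) \<and> le G l e \<and>
               z = colim_can G A (tgt G (restr G l g))
                     (act A (l, restr G l g) (act A (e, l) a)))\<rparr>"

text \<open>The homomorphisms induced on colimits by a \<open>G\<close>-map \<open>\<eta>\<close> from \<open>A\<close> to \<open>A'\<close>.\<close>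

definition colim_map :: "'g ord_gpd \<Rightarrow> ('g, 'a) gmodule \<Rightarrow> ('g, 'b) gmodule \<Rightarrow>
    ('g \<Rightarrow> 'a \<Rightarrow> 'b) \<Rightarrow> 'g set \<Rightarrow> ('g \<Rightarrow> 'a) set \<Rightarrow> ('g \<Rightarrow> 'b) set" where
  "colim_map G A A' \<eta> =
     (\<lambda>x\<in>obj (quot G). THE h.
        h \<in> hom (colim_grp G A x) (colim_grp G A' x) \<inter> extensional (carrier (colim_grp G A x)) \<and>
        (\<forall>e\<in>x \<inter> obj G. \<forall>a\<in>carrier (grp A e). h (colim_can G A e a) = colim_can G A' e (\<eta> e a)))"


section \<open>Transposition\<close>

text \<open>
  The canonical maps \<open>\<alpha>\<^sub>e\<close> as a \<open>G\<close>-map from \<open>A\<close> to the expansion of its colimit, and the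
  resulting map from \<open>G/\<beta>\<close>-maps \<open>colim A \<rightarrow> B\<close> to \<open>G\<close>-maps from \<open>A\<close> to the expansion of \<open>B\<close>.
  Since the carrier type of \<open>colim G A\<close> differs from that of \<open>A\<close>, an existentially quantified
  family of such maps would be confined to modules over two fixed carrier types; an explicit
  polymorphic one is not.
\<close>

definition colim_unit :: "'g ord_gpd \<Rightarrow> ('g, 'a) gmodule \<Rightarrow> 'g \<Rightarrow> 'a \<Rightarrow> ('g \<Rightarrow> 'a) set" where
  "colim_unit G A = (\<lambda>e\<in>obj G. \<lambda>a\<in>carrier (grp A e). colim_can G A e a)"

definition adj_transpose :: "'g ord_gpd \<Rightarrow> ('g, 'a) gmodule \<Rightarrow>
    ('g set \<Rightarrow> ('g \<Rightarrow> 'a) set \<Rightarrow> 'b) \<Rightarrow> 'g \<Rightarrow> 'a \<Rightarrow> 'b" where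
  "adj_transpose G A \<phi> = nt_comp (LL G) A (colim_unit G A) (expand_map G \<phi>)"

end

theory Submission
  imports Defs "HOL-Algebra.Free_Abelian_Groups"
begin

text \<open>
  For principally directed \<open>G\<close> the identities in a \<open>\<beta>\<close>-class form a directed set, so every
  element of the colimit over a class is of the form \<open>a \<alpha>\<^sub>e\<close>; hence a homomorphism from the
  colimit is determined by its values on these elements, and exists as soon as the values form a
  cocone. All constructions reduce to this: \<open>a \<mapsto> (a \<lhd> (e, g)) \<alpha>\<^sub>z\<close> with \<open>z = g\<^sup>-\<^sup>1g\<close> is a
  cocone and depends only on the class of \<open>g\<close>, because for \<open>k \<le> g\<close> the element \<open>a \<lhd> (e, k)\<close> is
  the image of \<open>a \<lhd> (e, g)\<close> under \<open>k\<^sup>-\<^sup>1k \<le> g\<^sup>-\<^sup>1g\<close>. This makes the action of \<open>G/\<beta>\<close> on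
  the colimit well defined without an explicit description of equality in the colimit. A \<open>G\<close>-map
  into an expanded module is a cocone, since identities act trivially there, and its factorization
  through the colimit is the inverse of transposition.
\<close>

section \<open>Ordered groupoids and restriction\<close>

context groupoid
begin

lemma obj_arr: "e \<in> obj G \<Longrightarrow> e \<in> arr G"
  using idn_arr idn_self by force

lemma src_obj_eq: "e \<in> obj G \<Longrightarrow> src G e = e"
  using src_idn idn_self by force

lemma tgt_obj_eq: "e \<in> obj G \<Longrightarrow> tgt G e = e"
  using tgt_idn idn_self by force

lemma cmp_src: "g \<in> arr G \<Longrightarrow> cmp G (src G g) g = g"
  using cmp_idn_left idn_self src_obj by metis

lemma cmp_tgt: "g \<in> arr G \<Longrightarrow> cmp G g (tgt G g) = g"
  using cmp_idn_right idn_self tgt_obj by metis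

lemma ginv:
  assumes g: "g \<in> arr G"
  shows "ginv G g \<in> arr G" "src G (ginv G g) = tgt G g" "tgt G (ginv G g) = src G g"
    "cmp G g (ginv G g) = src G g" "cmp G (ginv G g) g = tgt G g"
proof -
  let ?P = "\<lambda>h. h \<in> arr G \<and> src G h = tgt G g \<and> tgt G h = src G g \<and>
     cmp G g h = src G g \<and> cmp G h g = tgt G g"
  obtain h where h: "?P h"
    using invertible[OF g] by blast
  \<comment> \<open>Two inverses agree, as \<open>k = k (g h) = (k g) h = h\<close>; this makes the
    description in \<open>ginv\<close> definite.\<close>
  have "k = h" if k: "?P k" for k
    using cmp_assoc[of k g h] cmp_tgt[of k] cmp_src[of h] g h k by simp
  with h have "?P (ginv G g)"
    unfolding ginv_def by (rule theI)
  then show "ginv G g \<in> arr G" "src G (ginv G g) = tgt G g" "tgt G (ginv G g) = src G g"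
    "cmp G g (ginv G g) = src G g" "cmp G (ginv G g) g = tgt G g"
    by blast+
qed

end

context ordered_groupoid
begin

text \<open>\<open>OG1\<close> makes the inverses comparable, and \<open>OG2\<close> then compares
  the product of \<open>x\<close> and its inverse with that of \<open>y\<close> and its inverse;
  these products are the domain identities.\<close>

lemma src_mono: "\<lbrakk>x \<in> arr G; y \<in> arr G; le G x y\<rbrakk> \<Longrightarrow> le G (src G x) (src G y)"
  using OG2[of x y "ginv G x" "ginv G y"] OG1[of x y] by (simp add: ginv)

lemma tgt_mono: "\<lbrakk>x \<in> arr G; y \<in> arr G; le G x y\<rbrakk> \<Longrightarrow> le G (tgt G x) (tgt G y)"
  using OG2[of "ginv G x" "ginv G y" x y] OG1[of x y] by (simp add: ginv)

text \<open>Both \<open>k\<close> and its domain lie below \<open>e\<close> and have domain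
  \<open>src G k\<close>, so uniqueness in \<open>OG3\<close> identifies them.\<close>

lemma le_obj:
  assumes "k \<in> arr G" "e \<in> obj G" "le G k e"
  shows "k \<in> obj G"
proof -
  have le: "le G (src G k) e"
    using src_mono[of k e] assms by (simp add: obj_arr src_obj_eq)
  then have "k = src G k"
    using OG3[of e "src G k"] assms
    by (metis obj_arr src_obj src_obj_eq)
  then show ?thesis
    using assms(1) src_obj by metis
qed

lemma restr_eq: "\<lbrakk>x \<in> arr G; z \<in> arr G; le G z x\<rbrakk> \<Longrightarrow> restr G (src G z) x = z"
  unfolding restr_def using OG3[of x "src G z"] src_mono src_obj
  by (intro the1_equality) auto

lemma corestr_eq: "\<lbrakk>x \<in> arr G; z \<in> arr G; le G z x\<rbrakk> \<Longrightarrow> corestr G x (tgt G z) = z"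
  unfolding corestr_def using OG4[of x "tgt G z"] tgt_mono tgt_obj
  by (intro the1_equality) auto

lemma restr:
  assumes "x \<in> arr G" "e \<in> obj G" "le G e (src G x)"
  shows "restr G e x \<in> arr G" "src G (restr G e x) = e" "le G (restr G e x) x"
  using theI'[OF OG3[OF assms]] unfolding restr_def by auto

lemma corestr:
  assumes "x \<in> arr G" "e \<in> obj G" "le G e (tgt G x)"
  shows "corestr G x e \<in> arr G" "tgt G (corestr G x e) = e" "le G (corestr G x e) x"
  using theI'[OF OG4[OF assms]] unfolding corestr_def by auto

lemma restr_src: "x \<in> arr G \<Longrightarrow> restr G (src G x) x = x"
  by (simp add: restr_eq le_refl)

lemma corestr_tgt: "x \<in> arr G \<Longrightarrow> corestr G x (tgt G x) = x"
  by (simp add: corestr_eq le_refl)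

lemma corestr_obj: "\<lbrakk>e \<in> obj G; f \<in> obj G; le G f e\<rbrakk> \<Longrightarrow> corestr G e f = f"
  using corestr_eq[of e f] by (simp add: obj_arr tgt_obj_eq)

section \<open>The relation \<beta> in an ordered groupoid\<close>

lemma beta_iff: "(g, h) \<in> beta G \<longleftrightarrow> g \<in> arr G \<and> h \<in> arr G \<and> (\<exists>k\<in>arr G. le G k g \<and> le G k h)"
  by (simp add: beta_def)

lemma le_beta: "\<lbrakk>x \<in> arr G; y \<in> arr G; le G x y\<rbrakk> \<Longrightarrow> (x, y) \<in> beta G"
  using le_refl by (auto simp: beta_iff)

lemma beta_src: "(g, h) \<in> beta G \<Longrightarrow> (src G g, src G h) \<in> beta G"
  unfolding beta_iff by (meson obj_arr src_mono src_obj)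

lemma beta_tgt: "(g, h) \<in> beta G \<Longrightarrow> (tgt G g, tgt G h) \<in> beta G"
  unfolding beta_iff by (meson obj_arr tgt_mono tgt_obj)

text \<open>The relation \<open>beta\<close> provides a common lower bound only among all arrows;
  lying below the identity \<open>f\<close>, it is itself an identity by
  \<open>le_obj\<close>.\<close>

lemma beta_lower:
  assumes "(e, f) \<in> beta G" "f \<in> obj G"
  obtains l where "l \<in> obj G" "le G l e" "le G l f"
  using assms le_obj by (auto simp: beta_iff)

end

section \<open>The quotient groupoid\<close>

context principally_directed_ordered_groupoid
begin

lemma equiv_beta: "equiv (arr G) (beta G)"
proof (rule equivI)
  show "beta G \<subseteq> arr G \<times> arr G"
    by (auto simp: beta_iff)
  show "refl_on (arr G) (beta G)"
    by (auto simp: refl_on_def beta_iff intro: le_refl)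
  show "sym (beta G)"
    by (auto simp: sym_def beta_iff)
  \<comment> \<open>Principal directedness enters here: a lower bound of \<open>x\<close> and
    \<open>y\<close> and one of \<open>y\<close> and \<open>z\<close> both lie in the ideal below
    \<open>y\<close>, and a common lower bound of these two relates \<open>x\<close> to
    \<open>z\<close>.\<close>
  show "trans (beta G)"
  proof (rule transI)
    fix x y z
    assume "(x, y) \<in> beta G" "(y, z) \<in> beta G"
    then obtain k m where "x \<in> arr G" "y \<in> arr G" "z \<in> arr G" "k \<in> arr G" "m \<in> arr G"
      "le G k x" "le G k y" "le G m y" "le G m z"
      by (auto simp: beta_iff)
    moreover from this obtain n where "n \<in> arr G" "le G n k" "le G n m"
      using principally_directed[of y k m] by blast
    ultimately show "(x, z) \<in> beta G"
      unfolding beta_iff by (meson le_trans)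
  qed
qed

lemma class_eq_iff: "\<lbrakk>g \<in> arr G; h \<in> arr G\<rbrakk> \<Longrightarrow> beta_class G g = beta_class G h \<longleftrightarrow> (g, h) \<in> beta G"
  using eq_equiv_class_iff[OF equiv_beta] by blast

lemma class_eqI: "(g, h) \<in> beta G \<Longrightarrow> beta_class G g = beta_class G h"
  using equiv_class_eq[OF equiv_beta] by blast

lemma class_eq_le: "\<lbrakk>x \<in> arr G; y \<in> arr G; le G x y\<rbrakk> \<Longrightarrow> beta_class G x = beta_class G y"
  by (simp add: class_eqI le_beta)

text \<open>An arrow \<open>(e, g)\<close> of \<open>LL G\<close> starts at \<open>e\<close> and not
  at the domain of \<open>g\<close>. On classes this difference disappears, which allows such arrows
  to act through \<open>quot G\<close>.\<close>

lemma class_src_le: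
  "\<lbrakk>e \<in> obj G; g \<in> arr G; le G (src G g) e\<rbrakk> \<Longrightarrow> beta_class G (src G g) = beta_class G e"
  by (rule class_eq_le[OF obj_arr[OF src_obj] obj_arr])

lemma class_self: "g \<in> arr G \<Longrightarrow> g \<in> beta_class G g"
  by (rule equiv_class_self[OF equiv_beta])

lemma mem_class: "h \<in> beta_class G g \<Longrightarrow> h \<in> arr G \<and> beta_class G g = beta_class G h"
  using class_eqI by (auto simp: beta_iff)

text \<open>Directedness of the identities in a class: \<open>beta_lower\<close> gives the bound,
  and lying below \<open>e\<close> keeps it in the class of \<open>e\<close>.\<close>

lemma lower_bound:
  assumes "e \<in> obj G" "f \<in> obj G" "beta_class G e = beta_class G f"
  obtains l where "l \<in> obj G" "le G l e" "le G l f" "beta_class G l = beta_class G e"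
  using assms beta_lower class_eq_iff class_eq_le obj_arr by metis

lemma obj_quot: "x \<in> obj (quot G) \<longleftrightarrow> (\<exists>e\<in>obj G. x = beta_class G e)"
  by (auto simp: quot_def)

lemma arr_quot: "p \<in> arr (quot G) \<longleftrightarrow> (\<exists>g\<in>arr G. p = beta_class G g)"
  by (auto simp: quot_def quotient_def)

lemma class_obj_quot: "e \<in> obj G \<Longrightarrow> beta_class G e \<in> obj (quot G)"
  by (auto simp: quot_def)

lemma class_arr_quot: "g \<in> arr G \<Longrightarrow> beta_class G g \<in> arr (quot G)"
  by (auto simp: arr_quot)

lemma idn_quot: "idn (quot G) x = x"
  by (simp add: quot_def)

lemma obj_quot_mem: "\<lbrakk>x \<in> obj (quot G); e \<in> obj G\<rbrakk> \<Longrightarrow> e \<in> x \<longleftrightarrow> beta_class G e = x"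
  using class_self mem_class obj_arr by (metis obj_quot)

lemma arr_quot_mem:
  assumes "p \<in> arr (quot G)"
  shows "g \<in> p \<longleftrightarrow> g \<in> arr G \<and> beta_class G g = p"
proof -
  obtain h where h: "h \<in> arr G" "p = beta_class G h"
    using assms arr_quot by blast
  show ?thesis
    using mem_class[of g h] class_self[of g] h(2) by blast
qed

text \<open>The structure maps of \<open>quot G\<close> are \<beta>-images of the sets of values at
  all representatives. To evaluate them it is enough to find one value that is related to all the
  others.\<close>

lemma Image_beta_singleton:
  assumes "z \<in> S" "\<And>y. y \<in> S \<Longrightarrow> (z, y) \<in> beta G"
  shows "beta G `` S = beta_class G z"
  using assms class_eqI by blast

section \<open>Domain, range and composition of classes\<close>

lemma src_quot:
  assumes "g \<in> arr G"
  shows "src (quot G) (beta_class G g) = beta_class G (src G g)"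
proof -
  have "beta G `` (src G ` beta_class G g) = beta_class G (src G g)"
    using assms class_self[of g] by (intro Image_beta_singleton) (auto intro: beta_src)
  then show ?thesis
    by (simp add: quot_def)
qed

lemma tgt_quot:
  assumes "g \<in> arr G"
  shows "tgt (quot G) (beta_class G g) = beta_class G (tgt G g)"
proof -
  have "beta G `` (tgt G ` beta_class G g) = beta_class G (tgt G g)"
    using assms class_self[of g] by (intro Image_beta_singleton) (auto intro: beta_tgt)
  then show ?thesis
    by (simp add: quot_def)
qed

lemma src_quot_obj: "p \<in> arr (quot G) \<Longrightarrow> src (quot G) p \<in> obj (quot G)"
  by (auto simp: arr_quot src_quot obj_quot intro: src_obj)

lemma tgt_quot_obj: "p \<in> arr (quot G) \<Longrightarrow> tgt (quot G) p \<in> obj (quot G)"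
  by (auto simp: arr_quot tgt_quot obj_quot intro: tgt_obj)

lemma obj_quot_arr: "x \<in> obj (quot G) \<Longrightarrow> x \<in> arr (quot G)"
  by (auto simp: arr_quot obj_quot intro: obj_arr)

lemma src_tgt_obj_quot:
  assumes "x \<in> obj (quot G)"
  shows "src (quot G) x = x" "tgt (quot G) x = x"
  using assms by (auto simp: obj_quot src_quot tgt_quot obj_arr src_obj_eq tgt_obj_eq)

text \<open>Common lower bounds \<open>k\<close> of the first factors and \<open>m\<close> of the
  second need not be composable, but the range of \<open>k\<close> and the domain of
  \<open>m\<close> lie in one class. Cutting both down to a common lower identity \<open>u\<close>
  makes them composable, and by \<open>OG2\<close> the composite lies below both given ones.\<close>

lemma beta_cmp:
  assumes gh: "g \<in> arr G" "h \<in> arr G" "tgt G g = src G h"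
    and gh': "g' \<in> arr G" "h' \<in> arr G" "tgt G g' = src G h'"
    and b: "(g, g') \<in> beta G" "(h, h') \<in> beta G"
  shows "(cmp G g h, cmp G g' h') \<in> beta G"
proof -
  obtain k where k: "k \<in> arr G" "le G k g" "le G k g'"
    using b by (auto simp: beta_iff)
  obtain m where m: "m \<in> arr G" "le G m h" "le G m h'"
    using b by (auto simp: beta_iff)
  have "beta_class G (tgt G k) = beta_class G (tgt G g)"
    by (rule class_eqI[OF beta_tgt[OF le_beta]]) (use k gh in auto)
  also have "\<dots> = beta_class G (src G m)"
    unfolding gh(3) by (rule class_eqI[OF beta_src[OF le_beta], symmetric]) (use m gh in auto)
  finally obtain u where u: "u \<in> obj G" "le G u (tgt G k)" "le G u (src G m)"
    using lower_bound[of "tgt G k" "src G m"] k m src_obj tgt_obj by metis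
  let ?k = "corestr G k u" and ?m = "restr G u m"
  have K: "?k \<in> arr G" "tgt G ?k = u" "le G ?k k"
    using corestr[OF k(1) u(1,2)] by auto
  have M: "?m \<in> arr G" "src G ?m = u" "le G ?m m"
    using restr[OF m(1) u(1,3)] by auto
  have "le G ?k g" "le G ?k g'" "le G ?m h" "le G ?m h'"
    using K M k m gh gh' le_trans by meson+
  then have "le G (cmp G ?k ?m) (cmp G g h)" "le G (cmp G ?k ?m) (cmp G g' h')"
    using OG2 K M gh gh' by simp_all
  then show ?thesis
    unfolding beta_iff using K M gh gh' cmp_arr by metis
qed

lemma cmp_quot:
  assumes gh: "g \<in> arr G" "h \<in> arr G" "tgt G g = src G h"
  shows "cmp (quot G) (beta_class G g) (beta_class G h) = beta_class G (cmp G g h)"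
proof -
  let ?S = "{cmp G (corestr G g' f) (restr G f h') | g' f h'.
    g' \<in> beta_class G g \<and> h' \<in> beta_class G h \<and> f \<in> obj G \<and> le G f (tgt G g') \<and> le G f (src G h')}"
  have "beta G `` ?S = beta_class G (cmp G g h)"
  proof (rule Image_beta_singleton)
    \<comment> \<open>For composable representatives \<open>f\<close> may be chosen as their common
      identity, where restriction and corestriction change nothing.\<close>
    have "cmp G g h = cmp G (corestr G g (tgt G g)) (restr G (tgt G g) h)"
      using gh corestr_tgt[of g] restr_src[of h] by simp
    moreover have "tgt G g \<in> obj G" "le G (tgt G g) (tgt G g)" "le G (tgt G g) (src G h)"
      using gh le_refl obj_arr tgt_obj by metis+
    ultimately show "cmp G g h \<in> ?S"
      using class_self[OF gh(1)] class_self[OF gh(2)] by blast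
    fix y
    assume "y \<in> ?S"
    then obtain g' f h' where y: "y = cmp G (corestr G g' f) (restr G f h')"
      and b: "(g, g') \<in> beta G" "(h, h') \<in> beta G"
      and f: "f \<in> obj G" "le G f (tgt G g')" "le G f (src G h')"
      by blast
    have arr: "g' \<in> arr G" "h' \<in> arr G"
      using b by (auto simp: beta_iff)
    note c = corestr[OF arr(1) f(1,2)] and r = restr[OF arr(2) f(1,3)]
    have "(g, corestr G g' f) \<in> beta G" "(h, restr G f h') \<in> beta G"
      using b c r arr gh class_eq_iff class_eq_le by metis+
    then show "(cmp G g h, y) \<in> beta G"
      unfolding y using c r gh by (intro beta_cmp) auto
  qed
  then show ?thesis
    by (simp add: quot_def)
qed

text \<open>Representatives may be replaced by smaller elements without leaving their classes. The
  first is restricted to an identity below \<open>e\<close>; then both are cut down to a common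
  lower identity of the range of the first and the domain of the second. The bound \<open>e\<close>
  on the domain ensures that \<open>(e, g)\<close> is an arrow of \<open>LL G\<close>.\<close>

lemma composable_reps:
  assumes p: "p \<in> arr (quot G)" and q: "q \<in> arr (quot G)" and pq: "tgt (quot G) p = src (quot G) q"
    and e: "e \<in> obj G" "beta_class G e = src (quot G) p"
  obtains g h where "g \<in> arr G" "h \<in> arr G" "tgt G g = src G h" "le G (src G g) e"
    "p = beta_class G g" "q = beta_class G h"
proof -
  obtain g h where g: "g \<in> arr G" "p = beta_class G g" and h: "h \<in> arr G" "q = beta_class G h"
    using p q by (auto simp: arr_quot)
  obtain l where l: "l \<in> obj G" "le G l (src G g)" "le G l e"
    using lower_bound[of "src G g" e] e g src_obj src_quot by metis
  let ?g = "restr G l g"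
  have g': "?g \<in> arr G" "src G ?g = l" "le G ?g g"
    using restr[OF g(1) l(1,2)] by auto
  then have pg': "p = beta_class G ?g"
    using g class_eq_le by metis
  obtain u where u: "u \<in> obj G" "le G u (tgt G ?g)" "le G u (src G h)"
    using lower_bound[of "tgt G ?g" "src G h"] pq pg' h g' src_obj tgt_obj src_quot tgt_quot by metis
  note c = corestr[OF g'(1) u(1,2)] and r = restr[OF h(1) u(1,3)]
  \<comment> \<open>Corestriction changes the domain of the first representative once more, but only
    downwards, so it remains below \<open>e\<close>.\<close>
  have "le G (src G (corestr G ?g u)) (src G ?g)"
    using src_mono c g' by blast
  then have "le G (src G (corestr G ?g u)) e"
    using le_trans l e g' c obj_arr src_obj by metis
  moreover have "p = beta_class G (corestr G ?g u)" "q = beta_class G (restr G u h)"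
    using pg' h class_eq_le c r g' by metis+
  ultimately show thesis
    using that c r by metis
qed

section \<open>Modules and their colimits\<close>

lemma module_group: "\<lbrakk>G_module G A; e \<in> obj G\<rbrakk> \<Longrightarrow> comm_group (grp A e)"
  by (simp add: is_ab_functor_def LL_def)

lemma module_one_closed: "\<lbrakk>G_module G A; e \<in> obj G\<rbrakk> \<Longrightarrow> \<one>\<^bsub>grp A e\<^esub> \<in> carrier (grp A e)"
  by (meson comm_group.axioms(1) comm_monoid.axioms(1) module_group monoid.one_closed)

lemma module_act_hom:
  "\<lbrakk>G_module G A; e \<in> obj G; g \<in> arr G; le G (src G g) e\<rbrakk>
    \<Longrightarrow> act A (e, g) \<in> hom (grp A e) (grp A (tgt G g))"
  by (auto simp: is_ab_functor_def LL_def)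

lemma module_act_closed:
  "\<lbrakk>G_module G A; e \<in> obj G; g \<in> arr G; le G (src G g) e; a \<in> carrier (grp A e)\<rbrakk>
    \<Longrightarrow> act A (e, g) a \<in> carrier (grp A (tgt G g))"
  by (rule hom_in_carrier[OF module_act_hom])

lemma module_act_obj_hom:
  "\<lbrakk>G_module G A; e \<in> obj G; f \<in> obj G; le G f e\<rbrakk>
    \<Longrightarrow> act A (e, f) \<in> hom (grp A e) (grp A f)"
  using module_act_hom[of A e f] by (simp add: obj_arr src_obj_eq tgt_obj_eq)

lemma module_act_obj_closed:
  "\<lbrakk>G_module G A; e \<in> obj G; f \<in> obj G; le G f e; a \<in> carrier (grp A e)\<rbrakk>
    \<Longrightarrow> act A (e, f) a \<in> carrier (grp A f)"
  by (rule hom_in_carrier[OF module_act_obj_hom])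

lemma module_act_idn: "\<lbrakk>G_module G A; e \<in> obj G; a \<in> carrier (grp A e)\<rbrakk> \<Longrightarrow> act A (e, e) a = a"
  by (simp add: is_ab_functor_def LL_def)

text \<open>The functor law in \<open>LL G\<close>, from which the three laws below are obtained by
  specialization: \<open>h\<close> starting at the range of \<open>g\<close>, an identity as first
  factor, and an identity as second factor.\<close>

lemma module_act_cmp_corestr:
  assumes "G_module G A" "e \<in> obj G" "g \<in> arr G" "le G (src G g) e" "h \<in> arr G"
    "le G (src G h) (tgt G g)" "a \<in> carrier (grp A e)"
  shows "act A (e, cmp G (corestr G g (src G h)) h) a = act A (tgt G g, h) (act A (e, g) a)"
proof -
  have cmp: "\<forall>p\<in>arr (LL G). \<forall>q\<in>arr (LL G). tgt (LL G) p = src (LL G) q \<longrightarrow>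
        (\<forall>a\<in>carrier (grp A (src (LL G) p)). act A (cmp (LL G) p q) a = act A q (act A p a))"
    using assms(1) by (simp add: is_ab_functor_def)
  have "(e, g) \<in> arr (LL G)" "(tgt G g, h) \<in> arr (LL G)"
    using assms by (auto simp: LL_def tgt_obj)
  from cmp[rule_format, OF this, of a] assms(7) show ?thesis
    by (simp add: LL_def)
qed

lemma module_act_cmp:
  assumes "G_module G A" "e \<in> obj G" "g \<in> arr G" "le G (src G g) e" "h \<in> arr G"
    "tgt G g = src G h" "a \<in> carrier (grp A e)"
  shows "act A (e, cmp G g h) a = act A (tgt G g, h) (act A (e, g) a)"
proof -
  have "le G (src G h) (tgt G g)"
    using assms by (metis le_refl obj_arr src_obj)
  then show ?thesis
    using module_act_cmp_corestr[of A e g h a] assms corestr_tgt[of g] by simp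
qed

lemma module_act_restrict:
  assumes "G_module G A" "e \<in> obj G" "f \<in> obj G" "g \<in> arr G" "le G f e" "le G (src G g) f"
    "a \<in> carrier (grp A e)"
  shows "act A (e, g) a = act A (f, g) (act A (e, f) a)"
  using module_act_cmp_corestr[of A e f g a] assms
  by (simp add: obj_arr src_obj_eq tgt_obj_eq corestr_obj src_obj cmp_src)

text \<open>The element \<open>k\<close> is the corestriction of \<open>g\<close> to the range of
  \<open>k\<close>, so \<open>(e, k)\<close> is \<open>(e, g)\<close> followed by the passage from
  the range of \<open>g\<close> to that of \<open>k\<close>.\<close>

lemma module_act_le:
  assumes "G_module G A" "e \<in> obj G" "k \<in> arr G" "g \<in> arr G" "le G k g" "le G (src G g) e"
    "a \<in> carrier (grp A e)"
  shows "act A (e, k) a = act A (tgt G g, tgt G k) (act A (e, g) a)"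
  using module_act_cmp_corestr[of A e g "tgt G k" a] assms
  by (simp add: obj_arr src_obj_eq tgt_obj tgt_mono corestr_eq cmp_tgt)

section \<open>Direct sums over a class and the colimit as their quotient\<close>

lemma carrier_class_sum:
  assumes "G_module G A"
  shows "carrier (class_sum G A x) = {s \<in> \<Pi>\<^sub>E i\<in>x \<inter> obj G. carrier (grp A i).
    finite {i \<in> x \<inter> obj G. s i \<noteq> \<one>\<^bsub>grp A i\<^esub>}}"
  unfolding class_sum_def using module_group[OF assms] comm_group.axioms(2)
  by (intro carrier_sum_group) blast

lemma group_class_sum:
  assumes "G_module G A"
  shows "comm_group (class_sum G A x)"
proof -
  have grp: "comm_group (grp A i)" if "i \<in> x \<inter> obj G" for i
    using that module_group[OF assms] by blast
  then have group: "group (grp A i)" if "i \<in> x \<inter> obj G" for i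
    using that comm_group.axioms(2) by blast
  have "group (class_sum G A x)"
    unfolding class_sum_def by (rule sum_group) (rule group)
  then show ?thesis
  proof (rule group.group_comm_groupI)
    fix s t
    assume "s \<in> carrier (class_sum G A x)" "t \<in> carrier (class_sum G A x)"
    then have "s i \<in> carrier (grp A i)" "t i \<in> carrier (grp A i)" if "i \<in> x \<inter> obj G" for i
      using that by (auto simp: carrier_class_sum[OF assms])
    then show "s \<otimes>\<^bsub>class_sum G A x\<^esub> t = t \<otimes>\<^bsub>class_sum G A x\<^esub> s"
      unfolding class_sum_def mult_sum_group
      by (intro restrict_ext comm_monoid.m_comm[OF comm_group.axioms(1)[OF grp]])
  qed
qed

lemma class_inj_hom:
  assumes A: "G_module G A" and e: "e \<in> x \<inter> obj G"
  shows "class_inj G A x e \<in> hom (grp A e) (class_sum G A x)"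
proof (rule homI)
  \<comment> \<open>At indices other than \<open>e\<close> the homomorphism law for
    \<open>class_inj\<close> reads as a product of two units.\<close>
  have one: "\<one>\<^bsub>grp A i\<^esub> \<in> carrier (grp A i)"
      "\<one>\<^bsub>grp A i\<^esub> \<otimes>\<^bsub>grp A i\<^esub> \<one>\<^bsub>grp A i\<^esub> = \<one>\<^bsub>grp A i\<^esub>" if "i \<in> x \<inter> obj G" for i
  proof -
    interpret comm_group "grp A i" using module_group[OF A] that by blast
    show "\<one>\<^bsub>grp A i\<^esub> \<in> carrier (grp A i)"
      "\<one>\<^bsub>grp A i\<^esub> \<otimes>\<^bsub>grp A i\<^esub> \<one>\<^bsub>grp A i\<^esub> = \<one>\<^bsub>grp A i\<^esub>" by simp_all
  qed
  show "class_inj G A x e a \<in> carrier (class_sum G A x)" if a: "a \<in> carrier (grp A e)" for a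
  proof -
    have "finite {i \<in> x \<inter> obj G. class_inj G A x e a i \<noteq> \<one>\<^bsub>grp A i\<^esub>}"
      by (rule finite_subset[of _ "{e}"]) (auto simp: class_inj_def)
    then show ?thesis
      using a one by (auto simp: carrier_class_sum[OF A] class_inj_def)
  qed
  show "class_inj G A x e (a \<otimes>\<^bsub>grp A e\<^esub> b) =
      class_inj G A x e a \<otimes>\<^bsub>class_sum G A x\<^esub> class_inj G A x e b" for a b
    using one by (auto simp: class_inj_def class_sum_def intro!: restrict_ext)
qed

lemma class_inj_closed:
  "\<lbrakk>G_module G A; e \<in> x \<inter> obj G; a \<in> carrier (grp A e)\<rbrakk>
    \<Longrightarrow> class_inj G A x e a \<in> carrier (class_sum G A x)"
  by (rule hom_in_carrier[OF class_inj_hom])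

lemma colim_rel_gens_closed:
  assumes A: "G_module G A"
  shows "{class_inj G A x e a \<otimes>\<^bsub>class_sum G A x\<^esub>
        inv\<^bsub>class_sum G A x\<^esub> (class_inj G A x f (act A (e, f) a)) | e f a.
      e \<in> x \<inter> obj G \<and> f \<in> x \<inter> obj G \<and> le G f e \<and> a \<in> carrier (grp A e)}
    \<subseteq> carrier (class_sum G A x)"
proof -
  interpret comm_group "class_sum G A x" by (rule group_class_sum[OF A])
  show ?thesis
    using class_inj_closed[OF A] module_act_obj_closed[OF A] by blast
qed

lemma subgroup_colim_rel:
  assumes A: "G_module G A"
  shows "subgroup (colim_rel G A x) (class_sum G A x)"
proof -
  interpret comm_group "class_sum G A x" by (rule group_class_sum[OF A])
  show ?thesis
    unfolding colim_rel_def by (rule generate_is_subgroup[OF colim_rel_gens_closed[OF A]])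
qed

lemma normal_colim_rel:
  assumes A: "G_module G A"
  shows "colim_rel G A x \<lhd> class_sum G A x"
proof -
  interpret comm_group "class_sum G A x" by (rule group_class_sum[OF A])
  show ?thesis
    using subgroup_colim_rel[OF A] by (simp add: normal_iff_subgroup)
qed

lemma group_colim: "G_module G A \<Longrightarrow> comm_group (colim_grp G A x)"
  unfolding colim_grp_def
  using comm_group.abelian_FactGroup group_class_sum subgroup_colim_rel by blast

lemma colim_coset_hom:
  "G_module G A \<Longrightarrow> (\<lambda>s. colim_rel G A x #>\<^bsub>class_sum G A x\<^esub> s) \<in> hom (class_sum G A x) (colim_grp G A x)"
  unfolding colim_grp_def using normal.r_coset_hom_Mod normal_colim_rel by blast

lemma colim_can_hom:
  assumes "G_module G A" "e \<in> obj G"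
  shows "colim_can G A e \<in> hom (grp A e) (colim_grp G A (beta_class G e))"
proof -
  have "e \<in> beta_class G e \<inter> obj G"
    using assms class_self obj_arr by blast
  from hom_compose[OF class_inj_hom[OF assms(1) this] colim_coset_hom[OF assms(1)]]
  show ?thesis
    by (simp add: colim_can_def[abs_def] comp_def)
qed

lemma colim_can_closed:
  "\<lbrakk>G_module G A; e \<in> obj G; a \<in> carrier (grp A e)\<rbrakk>
    \<Longrightarrow> colim_can G A e a \<in> carrier (colim_grp G A (beta_class G e))"
  by (rule hom_in_carrier[OF colim_can_hom])

text \<open>The quotient of the two injected elements is one of the generators of
  \<open>colim_rel\<close>, so their cosets coincide. This is the cocone property of the canonical
  maps.\<close>

lemma colim_can_le:
  assumes A: "G_module G A" and ef: "e \<in> obj G" "f \<in> obj G" "le G f e" and a: "a \<in> carrier (grp A e)"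
  shows "colim_can G A f (act A (e, f) a) = colim_can G A e a"
proof -
  define x where "x = beta_class G e"
  have x: "beta_class G f = x" "e \<in> x \<inter> obj G" "f \<in> x \<inter> obj G"
    using ef class_eq_le class_self obj_arr unfolding x_def by blast+
  interpret comm_group "class_sum G A x" by (rule group_class_sum[OF A])
  let ?s = "class_inj G A x e a" and ?t = "class_inj G A x f (act A (e, f) a)"
  have s: "?s \<in> carrier (class_sum G A x)" and t: "?t \<in> carrier (class_sum G A x)"
    using class_inj_closed[OF A] x a module_act_obj_closed[OF A] ef by auto
  have "?s \<otimes>\<^bsub>class_sum G A x\<^esub> inv\<^bsub>class_sum G A x\<^esub> ?t \<in> colim_rel G A x"
    unfolding colim_rel_def by (rule generate.incl) (use x ef a in blast)
  then have "?s \<in> colim_rel G A x #>\<^bsub>class_sum G A x\<^esub> ?t"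
    using subgroup.rcos_module_rev[OF subgroup_colim_rel[OF A] is_group t s] by blast
  then have "colim_rel G A x #>\<^bsub>class_sum G A x\<^esub> ?t = colim_rel G A x #>\<^bsub>class_sum G A x\<^esub> ?s"
    by (rule repr_independence[OF _ t subgroup_colim_rel[OF A]])
  then show ?thesis
    by (simp add: colim_can_def x(1) flip: x_def)
qed

text \<open>
  By directedness a finite sum of elements \<open>a\<^sub>i \<alpha>\<^sub>i\<close> is equal to \<open>a \<alpha>\<^sub>l\<close> for a common lower
  bound \<open>l\<close> of the indices \<open>i\<close>.
\<close>

lemma colim_can_surj:
  assumes A: "G_module G A" and x: "x \<in> obj (quot G)" and y: "y \<in> carrier (colim_grp G A x)"
  obtains e a where "e \<in> obj G" "beta_class G e = x" "a \<in> carrier (grp A e)" "y = colim_can G A e a"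
proof -
  interpret S: comm_group "class_sum G A x" by (rule group_class_sum[OF A])
  let ?N = "\<lambda>s. colim_rel G A x #>\<^bsub>class_sum G A x\<^esub> s"
  have N: "?N \<in> hom (class_sum G A x) (colim_grp G A x)"
    by (rule colim_coset_hom[OF A])
  have can: "?N (class_inj G A x i a) = colim_can G A i a" if "i \<in> x \<inter> obj G" for i a
    using that obj_quot_mem[OF x, of i] by (simp add: colim_can_def)
  \<comment> \<open>The induction runs over the finite support of \<open>s\<close>, with
    \<open>s\<close> arbitrary.\<close>
  have repr: "\<exists>e\<in>x \<inter> obj G. \<exists>a\<in>carrier (grp A e). ?N s = colim_can G A e a"
    if "finite F" "s \<in> carrier (class_sum G A x)" "{i \<in> x \<inter> obj G. s i \<noteq> \<one>\<^bsub>grp A i\<^esub>} = F" for F s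
    using that
  proof (induction F arbitrary: s rule: finite_induct)
    case empty
    \<comment> \<open>Even for empty support an index is required. The class \<open>x\<close>
      contains an identity \<open>e\<close>, and the unit at \<open>e\<close> injects to the trivial
      sum.\<close>
    obtain e where "e \<in> obj G" "beta_class G e = x"
      using x by (auto simp: obj_quot)
    then have e: "e \<in> x \<inter> obj G"
      using obj_quot_mem[OF x] by blast
    have "s \<in> extensional (x \<inter> obj G)"
      using empty(1) by (simp add: carrier_class_sum[OF A] PiE_def)
    moreover have "s i = \<one>\<^bsub>grp A i\<^esub>" if "i \<in> x \<inter> obj G" for i
      using empty(2) that by blast
    ultimately have "s = class_inj G A x e \<one>\<^bsub>grp A e\<^esub>"
      unfolding class_inj_def by (intro extensionalityI[of _ "x \<inter> obj G"]) auto
    moreover have "\<one>\<^bsub>grp A e\<^esub> \<in> carrier (grp A e)"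
      using module_one_closed[OF A] e by blast
    ultimately show ?case
      using can[OF e] e by metis
  next
    case (insert i F)
    have i: "i \<in> x \<inter> obj G"
      using insert.prems(2) by blast
    \<comment> \<open>\<open>t\<close> is \<open>s\<close> with its coordinate at \<open>i\<close>
      erased, so that its support is \<open>F\<close> and the induction hypothesis applies.\<close>
    define t where "t = (\<lambda>j\<in>x \<inter> obj G. if j = i then \<one>\<^bsub>grp A j\<^esub> else s j)"
    have grp: "comm_group (grp A j)" if "j \<in> x \<inter> obj G" for j
      using module_group[OF A] that by blast
    have sC: "s \<in> (\<Pi>\<^sub>E j\<in>x \<inter> obj G. carrier (grp A j))"
      using insert.prems by (simp add: carrier_class_sum[OF A])
    have supp: "{j \<in> x \<inter> obj G. t j \<noteq> \<one>\<^bsub>grp A j\<^esub>} = F"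
      using insert.prems(2) insert.hyps(2) by (auto simp: t_def split: if_splits)
    have one: "\<one>\<^bsub>grp A j\<^esub> \<in> carrier (grp A j)" if "j \<in> x \<inter> obj G" for j
      using module_one_closed[OF A] that by blast
    have "t \<in> (\<Pi>\<^sub>E j\<in>x \<inter> obj G. carrier (grp A j))"
      using sC one by (auto simp: t_def)
    then have tC: "t \<in> carrier (class_sum G A x)"
      using supp insert.hyps(1) by (simp add: carrier_class_sum[OF A])
    obtain e a where e: "e \<in> x \<inter> obj G" and a: "a \<in> carrier (grp A e)" and ta: "?N t = colim_can G A e a"
      using insert.IH[OF tC supp] by blast
    have si: "s i \<in> carrier (grp A i)"
      using sC i by blast
    have "s = t \<otimes>\<^bsub>class_sum G A x\<^esub> class_inj G A x i (s i)"
    proof (rule ext)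
      fix j
      show "s j = (t \<otimes>\<^bsub>class_sum G A x\<^esub> class_inj G A x i (s i)) j"
      proof (cases "j \<in> x \<inter> obj G")
        case True
        have "monoid (grp A j)"
          using grp[OF True] by (simp add: comm_group_def comm_monoid_def)
        moreover have "s j \<in> carrier (grp A j)"
          using sC True by blast
        ultimately show ?thesis
          using True by (auto simp: class_sum_def t_def class_inj_def)
      next
        case False
        then show ?thesis
          using PiE_arb[OF sC False] by (auto simp: class_sum_def)
      qed
    qed
    then have "?N s = ?N t \<otimes>\<^bsub>colim_grp G A x\<^esub> ?N (class_inj G A x i (s i))"
      using hom_mult[OF N tC class_inj_closed[OF A i si]] by simp
    also have "\<dots> = colim_can G A e a \<otimes>\<^bsub>colim_grp G A x\<^esub> colim_can G A i (s i)"
      by (simp add: ta can[OF i])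
    finally have Ns: "?N s = colim_can G A e a \<otimes>\<^bsub>colim_grp G A x\<^esub> colim_can G A i (s i)" .
    \<comment> \<open>The two canonical elements are moved to a common lower bound \<open>l\<close>
      by \<open>colim_can_le\<close>; there the homomorphism \<open>colim_can G A l\<close> merges
      them into one.\<close>
    obtain l where l: "l \<in> obj G" "le G l e" "le G l i" "beta_class G l = x"
      using lower_bound[of e i] e i obj_quot_mem[OF x] by (metis IntD1 IntD2)
    have ae: "act A (e, l) a \<in> carrier (grp A l)" and ai: "act A (i, l) (s i) \<in> carrier (grp A l)"
      using module_act_obj_closed[OF A] e i l a si by auto
    have "?N s = colim_can G A l (act A (e, l) a) \<otimes>\<^bsub>colim_grp G A x\<^esub> colim_can G A l (act A (i, l) (s i))"
      using colim_can_le[OF A _ l(1)] e i l a si Ns by simp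
    also have "\<dots> = colim_can G A l (act A (e, l) a \<otimes>\<^bsub>grp A l\<^esub> act A (i, l) (s i))"
      using hom_mult[OF colim_can_hom[OF A l(1)] ae ai] l(4) by simp
    finally show ?case
      using l ae ai grp[of l] obj_quot_mem[OF x, of l]
      by (meson IntI comm_group.axioms(1) comm_monoid.axioms(1) monoid.m_closed)
  qed
  obtain s where s: "s \<in> carrier (class_sum G A x)" "y = ?N s"
    using y by (auto simp: colim_grp_def carrier_FactGroup)
  then have "finite {i \<in> x \<inter> obj G. s i \<noteq> \<one>\<^bsub>grp A i\<^esub>}"
    by (simp add: carrier_class_sum[OF A])
  from repr[OF this s(1) refl] show thesis
    using that s(2) obj_quot_mem[OF x] by blast
qed

section \<open>Universal property of the colimit over a class\<close>

text \<open>A family of homomorphisms into the abelian group \<open>H\<close> extends to the direct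
  sum by multiplying the values of the coordinates. Compatibility sends the generators of
  \<open>colim_rel\<close> to the unit, so the extension factors through the quotient. Uniqueness is
  supplied separately by \<open>colim_can_surj\<close>.\<close>

lemma colim_universal:
  assumes A: "G_module G A" and H: "comm_group H"
    and hom: "\<And>e. e \<in> x \<inter> obj G \<Longrightarrow> \<eta> e \<in> hom (grp A e) H"
    and compat: "\<And>e f a. \<lbrakk>e \<in> x \<inter> obj G; f \<in> x \<inter> obj G; le G f e; a \<in> carrier (grp A e)\<rbrakk>
      \<Longrightarrow> \<eta> f (act A (e, f) a) = \<eta> e a"
    and x: "x \<in> obj (quot G)"
  shows "\<exists>k\<in>hom (colim_grp G A x) H. \<forall>e\<in>x \<inter> obj G. \<forall>a\<in>carrier (grp A e). k (colim_can G A e a) = \<eta> e a"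
proof -
  interpret S: comm_group "class_sum G A x" by (rule group_class_sum[OF A])
  interpret H: comm_group H by (rule H)
  have grp: "group (grp A i)" if "i \<in> x \<inter> obj G" for i
    using module_group[OF A] that comm_group.axioms(2) by blast
  \<comment> \<open>\<open>gfinprod\<close> multiplies the factors different from the unit, finitely
    many for an element of the direct sum, so the index set may be infinite.\<close>
  define K where "K = (\<lambda>s. gfinprod H (\<lambda>i. \<eta> i (s i)) (x \<inter> obj G))"
  have "K \<in> hom (class_sum G A x) H"
    unfolding K_def class_sum_def by (rule H.hom_group_sum[OF hom grp])
  then interpret K: group_hom "class_sum G A x" H K
    by unfold_locales
  have K_inj: "K (class_inj G A x e a) = \<eta> e a"
    if e: "e \<in> x \<inter> obj G" and a: "a \<in> carrier (grp A e)" for e a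
  proof -
    have one: "\<eta> i \<one>\<^bsub>grp A i\<^esub> = \<one>\<^bsub>H\<^esub>" if "i \<in> x \<inter> obj G" for i
      using hom_one[OF hom[OF that] grp[OF that]] H.is_group by blast
    have ea: "\<eta> e a \<in> carrier H"
      using hom_in_carrier[OF hom[OF e] a] .
    \<comment> \<open>Away from \<open>e\<close> the coordinates are units, which the maps
      \<open>\<eta> i\<close> preserve, so only the factor at \<open>e\<close> survives.\<close>
    have "gfinprod H (\<lambda>i. \<eta> i (class_inj G A x e a i)) (x \<inter> obj G) = gfinprod H (\<lambda>i. \<eta> e a) {e}"
      using e ea one by (intro H.gfinprod_mono_neutral_cong_right) (auto simp: class_inj_def)
    then show ?thesis
      using ea by (simp add: K_def)
  qed
  have "colim_rel G A x \<subseteq> kernel (class_sum G A x) H K"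
    unfolding colim_rel_def
  proof (rule S.generate_subgroup_incl[OF _ K.subgroup_kernel], safe)
    fix e f a
    assume ef: "e \<in> x" "e \<in> obj G" "f \<in> x" "f \<in> obj G" "le G f e" and a: "a \<in> carrier (grp A e)"
    have b: "act A (e, f) a \<in> carrier (grp A f)"
      using module_act_obj_closed[OF A] ef a by blast
    have "\<eta> e a \<in> carrier H"
      using hom_in_carrier[OF hom a] ef by blast
    then show "class_inj G A x e a \<otimes>\<^bsub>class_sum G A x\<^esub>
        inv\<^bsub>class_sum G A x\<^esub> (class_inj G A x f (act A (e, f) a)) \<in> kernel (class_sum G A x) H K"
      using ef a b class_inj_closed[OF A] K_inj compat by (simp add: kernel_def)
  qed
  from K.FactGroup_universal_kernel[OF normal_colim_rel[OF A] this]
  obtain k where k: "k \<in> hom (colim_grp G A x) H"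
    "\<And>s. s \<in> carrier (class_sum G A x) \<Longrightarrow> k (colim_rel G A x #>\<^bsub>class_sum G A x\<^esub> s) = K s"
    unfolding colim_grp_def by blast
  have "k (colim_can G A e a) = \<eta> e a" if e: "e \<in> x \<inter> obj G" and a: "a \<in> carrier (grp A e)" for e a
  proof -
    have "beta_class G e = x"
      using e obj_quot_mem[OF x] by blast
    then show ?thesis
      by (simp add: colim_can_def k(2)[OF class_inj_closed[OF A e a]] K_inj[OF e a])
  qed
  with k(1) show ?thesis
    by blast
qed

section \<open>The action of classes on the colimit\<close>

text \<open>By \<open>module_act_le\<close> the two elements differ by a transition map between the
  ranges, which the canonical maps absorb.\<close>

lemma colim_can_act_le:
  assumes "G_module G A" "e \<in> obj G" "k \<in> arr G" "g \<in> arr G" "le G k g" "le G (src G g) e"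
    "a \<in> carrier (grp A e)"
  shows "colim_can G A (tgt G k) (act A (e, k) a) = colim_can G A (tgt G g) (act A (e, g) a)"
  unfolding module_act_le[OF assms]
  by (intro colim_can_le tgt_obj tgt_mono module_act_closed assms)

text \<open>Both sides equal the value at a common lower bound of \<open>g\<close> and
  \<open>h\<close>. This is the independence of representatives on which the action rests.\<close>

lemma colim_can_act_beta:
  assumes A: "G_module G A" and e: "e \<in> obj G" and a: "a \<in> carrier (grp A e)"
    and gh: "g \<in> arr G" "h \<in> arr G" "beta_class G g = beta_class G h"
      "le G (src G g) e" "le G (src G h) e"
  shows "colim_can G A (tgt G g) (act A (e, g) a) = colim_can G A (tgt G h) (act A (e, h) a)"
proof -
  obtain k where "k \<in> arr G" "le G k g" "le G k h"
    using gh class_eq_iff by (auto simp: beta_iff)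
  then show ?thesis
    using colim_can_act_le[OF A e, of k] gh a by metis
qed

lemma grp_colim: "grp (colim G A) = colim_grp G A"
  by (simp add: colim_def)

lemma restr_rep:
  assumes p: "p \<in> arr (quot G)" and e: "e \<in> obj G" "beta_class G e = src (quot G) p"
  obtains g where "g \<in> arr G" "p = beta_class G g" "le G (src G g) e"
proof -
  \<comment> \<open>The range of \<open>p\<close>, regarded as an arrow, is composable with
    \<open>p\<close>; of the two representatives obtained only that of \<open>p\<close> is
    kept.\<close>
  have "tgt (quot G) p = src (quot G) (tgt (quot G) p)"
    using src_tgt_obj_quot tgt_quot_obj p by metis
  with p e show thesis
    using composable_reps[of p "tgt (quot G) p" e] that tgt_quot_obj obj_quot_arr by metis
qed

text \<open>A representative of \<open>p\<close> with domain below \<open>e\<close> is chosen for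
  each \<open>e\<close>, and the resulting maps form a cocone. By \<open>colim_can_act_beta\<close>
  the induced homomorphism has the stated value for every admissible representative, not only the
  chosen one. It serves as the witness for the description in \<open>colim\<close>.\<close>

lemma colim_act_exists:
  assumes A: "G_module G A" and p: "p \<in> arr (quot G)"
  obtains k where "k \<in> hom (colim_grp G A (src (quot G) p)) (colim_grp G A (tgt (quot G) p))"
    "\<And>e a g. \<lbrakk>e \<in> obj G; a \<in> carrier (grp A e); g \<in> arr G; p = beta_class G g; le G (src G g) e\<rbrakk>
      \<Longrightarrow> k (colim_can G A e a) = colim_can G A (tgt G g) (act A (e, g) a)"
proof -
  let ?x = "src (quot G) p"
  have x: "?x \<in> obj (quot G)"
    by (rule src_quot_obj[OF p])
  have "\<exists>g. g \<in> arr G \<and> p = beta_class G g \<and> le G (src G g) e" if "e \<in> ?x \<inter> obj G" for e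
    using that restr_rep[OF p] obj_quot_mem[OF x] by (metis IntD1 IntD2)
  then obtain \<gamma> where \<gamma>: "\<gamma> e \<in> arr G" "p = beta_class G (\<gamma> e)" "le G (src G (\<gamma> e)) e"
    if "e \<in> ?x \<inter> obj G" for e
    by metis
  let ?\<eta> = "\<lambda>e a. colim_can G A (tgt G (\<gamma> e)) (act A (e, \<gamma> e) a)"
  have "\<exists>k\<in>hom (colim_grp G A ?x) (colim_grp G A (tgt (quot G) p)).
    \<forall>e\<in>?x \<inter> obj G. \<forall>a\<in>carrier (grp A e). k (colim_can G A e a) = ?\<eta> e a"
  proof (rule colim_universal[OF A group_colim[OF A] _ _ x])
    show "?\<eta> e \<in> hom (grp A e) (colim_grp G A (tgt (quot G) p))" if e: "e \<in> ?x \<inter> obj G" for e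
    proof -
      have "tgt (quot G) p = beta_class G (tgt G (\<gamma> e))"
        using \<gamma>[OF e] tgt_quot by metis
      then show ?thesis
        using hom_compose[OF module_act_hom[OF A] colim_can_hom[OF A tgt_obj], of e "\<gamma> e"] \<gamma>[OF e] e
        by (simp add: comp_def)
    qed
    fix e f a
    assume e: "e \<in> ?x \<inter> obj G" and f: "f \<in> ?x \<inter> obj G" and fe: "le G f e" and a: "a \<in> carrier (grp A e)"
    \<comment> \<open>Acting first by \<open>(e, f)\<close> and then by \<open>\<gamma> f\<close> is
      acting by \<open>(e, \<gamma> f)\<close>, so the cocone condition compares two representatives
      of \<open>p\<close> at the same \<open>e\<close>.\<close>
    have "le G (src G (\<gamma> f)) e"
      using le_trans[of "src G (\<gamma> f)" f e] fe \<gamma>[OF f] e f obj_arr src_obj by blast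
    moreover have "act A (f, \<gamma> f) (act A (e, f) a) = act A (e, \<gamma> f) a"
      using module_act_restrict[OF A, of e f "\<gamma> f" a] e f fe a \<gamma>[OF f] by simp
    ultimately show "?\<eta> f (act A (e, f) a) = ?\<eta> e a"
      using colim_can_act_beta[OF A _ a, of "\<gamma> f" "\<gamma> e"] e \<gamma>[OF f] \<gamma>[OF e] by simp
  qed
  then obtain k where k: "k \<in> hom (colim_grp G A ?x) (colim_grp G A (tgt (quot G) p))"
    "\<And>e a. \<lbrakk>e \<in> ?x \<inter> obj G; a \<in> carrier (grp A e)\<rbrakk> \<Longrightarrow> k (colim_can G A e a) = ?\<eta> e a"
    by blast
  show thesis
  proof (rule that[OF k(1)])
    fix e a g
    assume e: "e \<in> obj G" and a: "a \<in> carrier (grp A e)"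
      and g: "g \<in> arr G" "p = beta_class G g" "le G (src G g) e"
    have "beta_class G e = ?x"
      using class_src_le[OF e g(1,3)] src_quot[OF g(1)] g(2) by simp
    then have ex: "e \<in> ?x \<inter> obj G"
      using e obj_quot_mem[OF x] by blast
    then show "k (colim_can G A e a) = colim_can G A (tgt G g) (act A (e, g) a)"
      using k(2)[OF ex a] colim_can_act_beta[OF A e a, of "\<gamma> e" g] \<gamma>[of e] g by simp
  qed
qed

text \<open>Whatever \<open>g\<close>, \<open>e\<close>, \<open>a\<close> and \<open>l\<close> are
  chosen in the definition of the action, \<open>restr G l g\<close> is a representative of
  \<open>p\<close> with domain \<open>l\<close> below \<open>e\<close>, so the value obtained is
  \<open>k y\<close>, which does not refer to the choices.\<close>

lemma colim_act_eq:
  assumes A: "G_module G A" and p: "p \<in> arr (quot G)" and y: "y \<in> carrier (colim_grp G A (src (quot G) p))"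
    and k: "\<And>e a g. \<lbrakk>e \<in> obj G; a \<in> carrier (grp A e); g \<in> arr G; p = beta_class G g; le G (src G g) e\<rbrakk>
      \<Longrightarrow> k (colim_can G A e a) = colim_can G A (tgt G g) (act A (e, g) a)"
  shows "act (colim G A) p y = k y"
proof -
  let ?P = "\<lambda>z. \<exists>g e a l. g \<in> p \<and> e \<in> obj G \<and> a \<in> carrier (grp A e) \<and>
               y = colim_can G A e a \<and> l \<in> obj G \<and> le G l (src G g) \<and> le G l e \<and>
               z = colim_can G A (tgt G (restr G l g))
                     (act A (l, restr G l g) (act A (e, l) a))"
  have eq: "z = k y" if Pz: "?P z" for z
  proof -
    obtain g e a l where *: "g \<in> p" "e \<in> obj G" "a \<in> carrier (grp A e)" "y = colim_can G A e a"
        "l \<in> obj G" "le G l (src G g)" "le G l e"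
        "z = colim_can G A (tgt G (restr G l g)) (act A (l, restr G l g) (act A (e, l) a))"
      using Pz by blast
    have g: "g \<in> arr G" "beta_class G g = p"
      using *(1) arr_quot_mem[OF p] by auto
    note r = restr[OF g(1) *(5,6)]
    have "p = beta_class G (restr G l g)"
      using class_eq_le[OF r(1) g(1) r(3)] g(2) by simp
    moreover have "le G l l"
      using *(5) le_refl obj_arr by blast
    ultimately show "z = k y"
      using k[OF *(2,3) r(1)] * r module_act_restrict[OF A *(2,5) r(1)] by simp
  qed
  obtain e a where e: "e \<in> obj G" "beta_class G e = src (quot G) p" "a \<in> carrier (grp A e)"
      "y = colim_can G A e a"
    using colim_can_surj[OF A src_quot_obj[OF p] y] by blast
  obtain g where g: "g \<in> arr G" "p = beta_class G g" "le G (src G g) e"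
    using restr_rep[OF p e(1,2)] by blast
  \<comment> \<open>For existence, \<open>l\<close> is taken to be the domain of a representative
    that already starts below \<open>e\<close>.\<close>
  have "g \<in> p" "src G g \<in> obj G" "le G (src G g) (src G g)"
    using g class_self src_obj le_refl obj_arr by blast+
  with e g have "?P (colim_can G A (tgt G (restr G (src G g) g))
      (act A (src G g, restr G (src G g) g) (act A (e, src G g) a)))" by blast
  then have "?P (k y)"
    using eq by metis
  then have "(THE z. ?P z) = k y"
    using eq by (rule the_equality)
  then show ?thesis
    by (simp add: colim_def)
qed

lemma colim_act_hom:
  assumes A: "G_module G A" and p: "p \<in> arr (quot G)"
  shows "act (colim G A) p \<in> hom (colim_grp G A (src (quot G) p)) (colim_grp G A (tgt (quot G) p))"
proof -
  obtain k where k: "k \<in> hom (colim_grp G A (src (quot G) p)) (colim_grp G A (tgt (quot G) p))"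
    "\<And>e a g. \<lbrakk>e \<in> obj G; a \<in> carrier (grp A e); g \<in> arr G; p = beta_class G g; le G (src G g) e\<rbrakk>
      \<Longrightarrow> k (colim_can G A e a) = colim_can G A (tgt G g) (act A (e, g) a)"
    by (rule colim_act_exists[OF A p]) (rule that)
  interpret L: comm_group "colim_grp G A (src (quot G) p)" by (rule group_colim[OF A])
  have "act (colim G A) p y = k y" if "y \<in> carrier (colim_grp G A (src (quot G) p))" for y
    by (rule colim_act_eq[OF A p that k(2)])
  with k(1) show ?thesis
    by (simp add: hom_def Pi_iff)
qed

text \<open>Working form of the action, free of the definite description and of the lower bound
  \<open>l\<close>; the later computations with the action use it.\<close>

lemma colim_act_can:
  assumes A: "G_module G A" and e: "e \<in> obj G" and a: "a \<in> carrier (grp A e)"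
    and g: "g \<in> arr G" "le G (src G g) e"
  shows "act (colim G A) (beta_class G g) (colim_can G A e a) = colim_can G A (tgt G g) (act A (e, g) a)"
proof -
  have p: "beta_class G g \<in> arr (quot G)"
    by (rule class_arr_quot[OF g(1)])
  have "src (quot G) (beta_class G g) = beta_class G e"
    unfolding src_quot[OF g(1)]
    by (rule class_src_le[OF e g])
  then have y: "colim_can G A e a \<in> carrier (colim_grp G A (src (quot G) (beta_class G g)))"
    using colim_can_closed[OF A e a] by simp
  show ?thesis
  proof (rule colim_act_exists[OF A p])
    fix k
    assume k: "\<And>e a h. \<lbrakk>e \<in> obj G; a \<in> carrier (grp A e); h \<in> arr G;
         beta_class G g = beta_class G h; le G (src G h) e\<rbrakk>
        \<Longrightarrow> k (colim_can G A e a) = colim_can G A (tgt G h) (act A (e, h) a)"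
    show ?thesis
      by (rule trans[OF colim_act_eq[OF A p y k] k[OF e a g(1) refl g(2)]])
  qed
qed

text \<open>By \<open>colim_can_surj\<close> the identity and composition laws need checking only on
  canonical elements, where \<open>colim_act_can\<close> reduces them to laws of \<open>A\<close>.
  For composition the representatives come from \<open>composable_reps\<close>.\<close>

lemma colim_module:
  assumes A: "G_module G A"
  shows "quot_module G (colim G A)"
  unfolding is_ab_functor_def grp_colim
proof (intro conjI ballI impI)
  show "comm_group (colim_grp G A x)" for x
    by (rule group_colim[OF A])
  show "act (colim G A) p \<in> hom (colim_grp G A (src (quot G) p)) (colim_grp G A (tgt (quot G) p))"
    if "p \<in> arr (quot G)" for p
    by (rule colim_act_hom[OF A that])
  show "act (colim G A) (idn (quot G) x) y = y"
    if x: "x \<in> obj (quot G)" and y: "y \<in> carrier (colim_grp G A x)" for x y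
  proof -
    obtain e a where e: "e \<in> obj G" "beta_class G e = x" "a \<in> carrier (grp A e)" "y = colim_can G A e a"
      using colim_can_surj[OF A x y] by blast
    have "le G e e"
      using e le_refl obj_arr by blast
    then show ?thesis
      using colim_act_can[OF A e(1,3) obj_arr[OF e(1)]] e
      by (simp add: idn_quot src_obj_eq tgt_obj_eq module_act_idn[OF A])
  qed
  fix p q y
  assume p: "p \<in> arr (quot G)" and q: "q \<in> arr (quot G)" and pq: "tgt (quot G) p = src (quot G) q"
    and y: "y \<in> carrier (colim_grp G A (src (quot G) p))"
  obtain e a where e: "e \<in> obj G" "beta_class G e = src (quot G) p" "a \<in> carrier (grp A e)"
      "y = colim_can G A e a"
    using colim_can_surj[OF A src_quot_obj[OF p] y] by blast
  obtain g h where gh: "g \<in> arr G" "h \<in> arr G" "tgt G g = src G h" "le G (src G g) e"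
      "p = beta_class G g" "q = beta_class G h"
    using composable_reps[OF p q pq e(1,2)] by blast
  have "le G (src G h) (tgt G g)"
    using gh le_refl obj_arr tgt_obj by metis
  then have "act (colim G A) q (act (colim G A) p y) =
      colim_can G A (tgt G h) (act A (tgt G g, h) (act A (e, g) a))"
    unfolding gh(5,6) e(4) colim_act_can[OF A e(1,3) gh(1,4)]
    by (intro colim_act_can[OF A tgt_obj[OF gh(1)] module_act_closed[OF A e(1) gh(1,4) e(3)] gh(2)])
  also have "\<dots> = colim_can G A (tgt G (cmp G g h)) (act A (e, cmp G g h) a)"
    using gh e module_act_cmp[OF A] by (simp add: tgt_cmp)
  also have "\<dots> = act (colim G A) (beta_class G (cmp G g h)) y"
    using gh e colim_act_can[OF A e(1,3), of "cmp G g h"] by (simp add: cmp_arr src_cmp)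
  finally show "act (colim G A) (cmp (quot G) p q) y = act (colim G A) q (act (colim G A) p y)"
    using gh by (simp add: cmp_quot)
qed

section \<open>Module maps, expansion and the adjunction\<close>

lemma G_mapsI:
  assumes "\<And>e. e \<in> obj G \<Longrightarrow> \<eta> e \<in> hom (grp A e) (grp A' e)"
    and "\<And>e. e \<in> obj G \<Longrightarrow> \<eta> e \<in> extensional (carrier (grp A e))"
    and "\<eta> \<in> extensional (obj G)"
    and "\<And>e g a. \<lbrakk>e \<in> obj G; g \<in> arr G; le G (src G g) e; a \<in> carrier (grp A e)\<rbrakk>
      \<Longrightarrow> \<eta> (tgt G g) (act A (e, g) a) = act A' (e, g) (\<eta> e a)"
  shows "\<eta> \<in> G_maps G A A'"
  using assms by (auto simp: nat_trans_def LL_def PiE_iff)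

lemma G_maps_hom: "\<lbrakk>\<eta> \<in> G_maps G A A'; e \<in> obj G\<rbrakk> \<Longrightarrow> \<eta> e \<in> hom (grp A e) (grp A' e)"
  by (auto simp: nat_trans_def LL_def PiE_iff)

lemma G_maps_closed:
  "\<lbrakk>\<eta> \<in> G_maps G A A'; e \<in> obj G; a \<in> carrier (grp A e)\<rbrakk> \<Longrightarrow> \<eta> e a \<in> carrier (grp A' e)"
  by (rule hom_in_carrier[OF G_maps_hom])

lemma G_maps_extensional:
  "\<eta> \<in> G_maps G A A' \<Longrightarrow> \<eta> \<in> extensional (obj G)"
  "\<lbrakk>\<eta> \<in> G_maps G A A'; e \<in> obj G\<rbrakk> \<Longrightarrow> \<eta> e \<in> extensional (carrier (grp A e))"
  by (auto simp: nat_trans_def LL_def PiE_iff)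

lemma G_maps_act:
  "\<lbrakk>\<eta> \<in> G_maps G A A'; e \<in> obj G; g \<in> arr G; le G (src G g) e; a \<in> carrier (grp A e)\<rbrakk>
    \<Longrightarrow> \<eta> (tgt G g) (act A (e, g) a) = act A' (e, g) (\<eta> e a)"
  by (auto simp: nat_trans_def LL_def)

lemma G_maps_act_obj:
  "\<lbrakk>\<eta> \<in> G_maps G A A'; e \<in> obj G; f \<in> obj G; le G f e; a \<in> carrier (grp A e)\<rbrakk>
    \<Longrightarrow> \<eta> f (act A (e, f) a) = act A' (e, f) (\<eta> e a)"
  using G_maps_act[of \<eta> A A' e f a] by (simp add: obj_arr src_obj_eq tgt_obj_eq)

lemma quot_mapsI:
  assumes "\<And>x. x \<in> obj (quot G) \<Longrightarrow> \<phi> x \<in> hom (grp B x) (grp B' x)"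
    and "\<And>x. x \<in> obj (quot G) \<Longrightarrow> \<phi> x \<in> extensional (carrier (grp B x))"
    and "\<phi> \<in> extensional (obj (quot G))"
    and "\<And>p b. \<lbrakk>p \<in> arr (quot G); b \<in> carrier (grp B (src (quot G) p))\<rbrakk>
      \<Longrightarrow> \<phi> (tgt (quot G) p) (act B p b) = act B' p (\<phi> (src (quot G) p) b)"
  shows "\<phi> \<in> quot_maps G B B'"
  using assms by (auto simp: nat_trans_def PiE_iff)

lemma quot_maps_hom:
  "\<lbrakk>\<phi> \<in> quot_maps G B B'; x \<in> obj (quot G)\<rbrakk> \<Longrightarrow> \<phi> x \<in> hom (grp B x) (grp B' x)"
  by (auto simp: nat_trans_def PiE_iff)

lemma quot_maps_extensional:
  "\<phi> \<in> quot_maps G B B' \<Longrightarrow> \<phi> \<in> extensional (obj (quot G))"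
  "\<lbrakk>\<phi> \<in> quot_maps G B B'; x \<in> obj (quot G)\<rbrakk> \<Longrightarrow> \<phi> x \<in> extensional (carrier (grp B x))"
  by (auto simp: nat_trans_def PiE_iff)

lemma quot_maps_act:
  assumes "\<phi> \<in> quot_maps G B B'" "e \<in> obj G" "g \<in> arr G" "le G (src G g) e"
    "b \<in> carrier (grp B (beta_class G e))"
  shows "\<phi> (beta_class G (tgt G g)) (act B (beta_class G g) b) =
    act B' (beta_class G g) (\<phi> (beta_class G e) b)"
proof -
  have "beta_class G (src G g) = beta_class G e"
    by (rule class_src_le[OF assms(2-4)])
  moreover have "\<forall>p\<in>arr (quot G). \<forall>b\<in>carrier (grp B (src (quot G) p)).
      \<phi> (tgt (quot G) p) (act B p b) = act B' p (\<phi> (src (quot G) p) b)"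
    using assms(1) by (simp add: nat_trans_def)
  ultimately show ?thesis
    using assms class_arr_quot[of g] src_quot[of g] tgt_quot[of g] by metis
qed

lemma quot_module_act_hom:
  assumes "quot_module G B" "e \<in> obj G" "g \<in> arr G" "le G (src G g) e"
  shows "act B (beta_class G g) \<in> hom (grp B (beta_class G e)) (grp B (beta_class G (tgt G g)))"
proof -
  have "beta_class G (src G g) = beta_class G e"
    by (rule class_src_le[OF assms(2-4)])
  moreover have "act B (beta_class G g) \<in>
      hom (grp B (src (quot G) (beta_class G g))) (grp B (tgt (quot G) (beta_class G g)))"
    using assms class_arr_quot by (simp add: is_ab_functor_def)
  ultimately show ?thesis
    using assms(3) by (simp add: src_quot tgt_quot)
qed

lemma quot_module_act_obj:
  "\<lbrakk>quot_module G B; e \<in> obj G; b \<in> carrier (grp B (beta_class G e))\<rbrakk> \<Longrightarrow> act B (beta_class G e) b = b"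
  using class_obj_quot[of e] by (simp add: is_ab_functor_def idn_quot)

lemma quot_module_act_cmp:
  assumes B: "quot_module G B" and gh: "g \<in> arr G" "h \<in> arr G" "tgt G g = src G h"
    and b: "b \<in> carrier (grp B (beta_class G (src G g)))"
  shows "act B (beta_class G (cmp G g h)) b = act B (beta_class G h) (act B (beta_class G g) b)"
proof -
  have "\<forall>p\<in>arr (quot G). \<forall>q\<in>arr (quot G). tgt (quot G) p = src (quot G) q \<longrightarrow>
        (\<forall>a\<in>carrier (grp B (src (quot G) p)). act B (cmp (quot G) p q) a = act B q (act B p a))"
    using B by (simp add: is_ab_functor_def)
  from this[rule_format, of "beta_class G g" "beta_class G h" b] show ?thesis
    using gh b by (simp add: src_quot tgt_quot cmp_quot class_arr_quot)
qed

section \<open>Functoriality of the colimit\<close>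

text \<open>Uniqueness half of the universal property: canonical elements exhaust each colimit, and
  extensionality fixes the values elsewhere.\<close>

lemma colim_eqI:
  assumes A: "G_module G A"
    and f: "f \<in> extensional (obj (quot G))"
      "\<And>x. x \<in> obj (quot G) \<Longrightarrow> f x \<in> extensional (carrier (colim_grp G A x))"
    and g: "g \<in> extensional (obj (quot G))"
      "\<And>x. x \<in> obj (quot G) \<Longrightarrow> g x \<in> extensional (carrier (colim_grp G A x))"
    and eq: "\<And>e a. \<lbrakk>e \<in> obj G; a \<in> carrier (grp A e)\<rbrakk>
      \<Longrightarrow> f (beta_class G e) (colim_can G A e a) = g (beta_class G e) (colim_can G A e a)"
  shows "f = g"
proof (rule extensionalityI[OF f(1) g(1)])
  fix x
  assume x: "x \<in> obj (quot G)"
  show "f x = g x"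
  proof (rule extensionalityI[OF f(2)[OF x] g(2)[OF x]])
    fix y
    assume "y \<in> carrier (colim_grp G A x)"
    then obtain e a where "e \<in> obj G" "beta_class G e = x" "a \<in> carrier (grp A e)" "y = colim_can G A e a"
      by (rule colim_can_surj[OF A x])
    then show "f x y = g x y"
      using eq by blast
  qed
qed

text \<open>Following \<eta> by the canonical maps of \<open>A'\<close> gives a cocone, by
  naturality of \<eta> at identities and \<open>colim_can_le\<close>. The induced homomorphism is
  the only one with these values by \<open>colim_can_surj\<close>, so the description in
  \<open>colim_map\<close> denotes it.\<close>

lemma colim_map:
  assumes A: "G_module G A" and A': "G_module G A'" and \<eta>: "\<eta> \<in> G_maps G A A'" and x: "x \<in> obj (quot G)"
  shows "colim_map G A A' \<eta> x \<in> hom (colim_grp G A x) (colim_grp G A' x)"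
    and "colim_map G A A' \<eta> x \<in> extensional (carrier (colim_grp G A x))"
    and colim_map_can: "\<lbrakk>e \<in> obj G; beta_class G e = x; a \<in> carrier (grp A e)\<rbrakk>
      \<Longrightarrow> colim_map G A A' \<eta> x (colim_can G A e a) = colim_can G A' e (\<eta> e a)"
proof -
  let ?P = "\<lambda>h. h \<in> hom (colim_grp G A x) (colim_grp G A' x) \<inter> extensional (carrier (colim_grp G A x)) \<and>
        (\<forall>e\<in>x \<inter> obj G. \<forall>a\<in>carrier (grp A e). h (colim_can G A e a) = colim_can G A' e (\<eta> e a))"
  have "\<exists>k\<in>hom (colim_grp G A x) (colim_grp G A' x).
      \<forall>e\<in>x \<inter> obj G. \<forall>a\<in>carrier (grp A e). k (colim_can G A e a) = colim_can G A' e (\<eta> e a)"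
  proof (rule colim_universal[OF A group_colim[OF A'] _ _ x])
    fix e
    assume e: "e \<in> x \<inter> obj G"
    then have "beta_class G e = x" "e \<in> obj G"
      using obj_quot_mem[OF x] by blast+
    then show "(\<lambda>a. colim_can G A' e (\<eta> e a)) \<in> hom (grp A e) (colim_grp G A' x)"
      using Group.hom_compose[OF G_maps_hom[OF \<eta>] colim_can_hom[OF A']] by (auto simp: comp_def)
  next
    fix e f a
    assume "e \<in> x \<inter> obj G" "f \<in> x \<inter> obj G" "le G f e" "a \<in> carrier (grp A e)"
    then show "colim_can G A' f (\<eta> f (act A (e, f) a)) = colim_can G A' e (\<eta> e a)"
      by (simp add: G_maps_act_obj[OF \<eta>] colim_can_le[OF A'] G_maps_closed[OF \<eta>])
  qed
  then obtain k where k: "k \<in> hom (colim_grp G A x) (colim_grp G A' x)"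
    "\<And>e a. \<lbrakk>e \<in> x \<inter> obj G; a \<in> carrier (grp A e)\<rbrakk> \<Longrightarrow> k (colim_can G A e a) = colim_can G A' e (\<eta> e a)"
    by blast
  have can: "colim_can G A e a \<in> carrier (colim_grp G A x)" if "e \<in> x \<inter> obj G" "a \<in> carrier (grp A e)" for e a
    using colim_can_closed[OF A, of e a] that obj_quot_mem[OF x, of e] by auto
  interpret L: comm_group "colim_grp G A x" by (rule group_colim[OF A])
  \<comment> \<open>The universal property leaves values outside the carrier open, whereas the
    description asks for an extensional map.\<close>
  have "restrict k (carrier (colim_grp G A x)) \<in> hom (colim_grp G A x) (colim_grp G A' x)"
    using k(1) by (simp add: hom_def Pi_iff)
  then have ex: "?P (restrict k (carrier (colim_grp G A x)))"
    using k(2) can by simp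
  have "h = restrict k (carrier (colim_grp G A x))" if h: "?P h" for h
  proof (rule extensionalityI[of _ "carrier (colim_grp G A x)"])
    fix y
    assume y: "y \<in> carrier (colim_grp G A x)"
    then obtain e a where ea: "e \<in> obj G" "beta_class G e = x" "a \<in> carrier (grp A e)" "y = colim_can G A e a"
      by (rule colim_can_surj[OF A x])
    then have "e \<in> x \<inter> obj G"
      using obj_quot_mem[OF x] by blast
    then show "h y = restrict k (carrier (colim_grp G A x)) y"
      using h k(2) ea y by simp
  qed (use h in simp_all)
  with ex have "?P (The ?P)"
    by (rule theI)
  moreover have "colim_map G A A' \<eta> x = The ?P"
    using x by (simp add: colim_map_def)
  ultimately have P: "?P (colim_map G A A' \<eta> x)"
    by simp
  show "colim_map G A A' \<eta> x \<in> hom (colim_grp G A x) (colim_grp G A' x)"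
    "colim_map G A A' \<eta> x \<in> extensional (carrier (colim_grp G A x))"
    using P by blast+
  show "colim_map G A A' \<eta> x (colim_can G A e a) = colim_can G A' e (\<eta> e a)"
    if "e \<in> obj G" "beta_class G e = x" "a \<in> carrier (grp A e)" for e a
    using P that obj_quot_mem[OF x, of e] by blast
qed

lemma colim_map_extensional_obj: "colim_map G A A' \<eta> \<in> extensional (obj (quot G))"
  by (simp add: colim_map_def)

text \<open>On a canonical element at \<open>e\<close>, with a representative \<open>g\<close> of
  \<open>p\<close> whose domain lies below \<open>e\<close>, naturality at \<open>p\<close> becomes
  naturality of \<eta> at \<open>(e, g)\<close>.\<close>

lemma colim_map_quot_maps:
  assumes A: "G_module G A" and A': "G_module G A'" and \<eta>: "\<eta> \<in> G_maps G A A'"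
  shows "colim_map G A A' \<eta> \<in> quot_maps G (colim G A) (colim G A')"
proof (rule quot_mapsI, unfold grp_colim)
  note colim_map = colim_map[OF A A' \<eta>]
  show "colim_map G A A' \<eta> x \<in> hom (colim_grp G A x) (colim_grp G A' x)"
    "colim_map G A A' \<eta> x \<in> extensional (carrier (colim_grp G A x))" if "x \<in> obj (quot G)" for x
    using colim_map that by blast+
  show "colim_map G A A' \<eta> \<in> extensional (obj (quot G))"
    by (rule colim_map_extensional_obj)
  fix p y
  assume p: "p \<in> arr (quot G)" and y: "y \<in> carrier (colim_grp G A (src (quot G) p))"
  obtain e a where e: "e \<in> obj G" "beta_class G e = src (quot G) p" and a: "a \<in> carrier (grp A e)"
      and ya: "y = colim_can G A e a"
    by (rule colim_can_surj[OF A src_quot_obj[OF p] y])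
  obtain g where g: "g \<in> arr G" "p = beta_class G g" "le G (src G g) e"
    by (rule restr_rep[OF p e])
  have t: "tgt G g \<in> obj G" "beta_class G (tgt G g) = tgt (quot G) p"
    using g tgt_obj tgt_quot by auto
  have "colim_map G A A' \<eta> (tgt (quot G) p) (act (colim G A) p y) =
      colim_map G A A' \<eta> (tgt (quot G) p) (colim_can G A (tgt G g) (act A (e, g) a))"
    unfolding ya g(2) by (simp only: colim_act_can[OF A e(1) a g(1,3)])
  also have "\<dots> = colim_can G A' (tgt G g) (\<eta> (tgt G g) (act A (e, g) a))"
    by (rule colim_map(3)[OF tgt_quot_obj[OF p] t module_act_closed[OF A e(1) g(1,3) a]])
  also have "\<dots> = colim_can G A' (tgt G g) (act A' (e, g) (\<eta> e a))"
    by (simp only: G_maps_act[OF \<eta> e(1) g(1,3) a])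
  also have "\<dots> = act (colim G A') p (colim_can G A' e (\<eta> e a))"
    unfolding g(2) by (rule colim_act_can[OF A' e(1) G_maps_closed[OF \<eta> e(1) a] g(1,3), symmetric])
  also have "\<dots> = act (colim G A') p (colim_map G A A' \<eta> (src (quot G) p) y)"
    unfolding ya by (simp only: colim_map(3)[OF src_quot_obj[OF p] e a])
  finally show "colim_map G A A' \<eta> (tgt (quot G) p) (act (colim G A) p y) =
      act (colim G A') p (colim_map G A A' \<eta> (src (quot G) p) y)" .
qed

lemma nt_id_G_maps:
  assumes "G_module G A"
  shows "nt_id (LL G) A \<in> G_maps G A A"
proof (rule G_mapsI)
  have nt: "nt_id (LL G) A e = (\<lambda>a\<in>carrier (grp A e). a)" if "e \<in> obj G" for e
    using that by (simp add: nt_id_def LL_def)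
  show "nt_id (LL G) A e \<in> hom (grp A e) (grp A e)" if "e \<in> obj G" for e
  proof -
    interpret comm_group "grp A e" by (rule module_group[OF assms that])
    show ?thesis
      using nt[OF that] by (simp add: hom_def Pi_iff)
  qed
  show "nt_id (LL G) A e \<in> extensional (carrier (grp A e))" if "e \<in> obj G" for e
    using nt[OF that] by simp
  show "nt_id (LL G) A \<in> extensional (obj G)"
    by (simp add: nt_id_def LL_def)
  show "nt_id (LL G) A (tgt G g) (act A (e, g) a) = act A (e, g) (nt_id (LL G) A e a)"
    if "e \<in> obj G" "g \<in> arr G" "le G (src G g) e" "a \<in> carrier (grp A e)" for e g a
    using that nt module_act_closed[OF assms that] tgt_obj by simp
qed

lemma nt_comp_G_maps:
  assumes A: "G_module G A" and \<eta>: "\<eta> \<in> G_maps G A A'" and \<theta>: "\<theta> \<in> G_maps G A' A''"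
  shows "nt_comp (LL G) A \<eta> \<theta> \<in> G_maps G A A''"
proof (rule G_mapsI)
  have nt: "nt_comp (LL G) A \<eta> \<theta> e = restrict (\<theta> e \<circ> \<eta> e) (carrier (grp A e))" if "e \<in> obj G" for e
    using that by (simp add: nt_comp_def LL_def comp_def)
  show "nt_comp (LL G) A \<eta> \<theta> e \<in> hom (grp A e) (grp A'' e)" if e: "e \<in> obj G" for e
  proof -
    interpret comm_group "grp A e" by (rule module_group[OF A e])
    have "\<theta> e \<circ> \<eta> e \<in> hom (grp A e) (grp A'' e)"
      by (rule Group.hom_compose[OF G_maps_hom[OF \<eta> e] G_maps_hom[OF \<theta> e]])
    then show ?thesis
      unfolding nt[OF e] by (simp add: hom_def Pi_iff)
  qed
  show "nt_comp (LL G) A \<eta> \<theta> e \<in> extensional (carrier (grp A e))" if "e \<in> obj G" for e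
    using nt[OF that] by simp
  show "nt_comp (LL G) A \<eta> \<theta> \<in> extensional (obj G)"
    by (simp add: nt_comp_def LL_def)
  show "nt_comp (LL G) A \<eta> \<theta> (tgt G g) (act A (e, g) a) = act A'' (e, g) (nt_comp (LL G) A \<eta> \<theta> e a)"
    if "e \<in> obj G" "g \<in> arr G" "le G (src G g) e" "a \<in> carrier (grp A e)" for e g a
    using that nt module_act_closed[OF A that] tgt_obj G_maps_act[OF \<eta> that]
      G_maps_act[OF \<theta> that(1-3) G_maps_closed[OF \<eta> that(1,4)]] by simp
qed

lemma colim_map_id:
  assumes A: "G_module G A"
  shows "colim_map G A A (nt_id (LL G) A) = nt_id (quot G) (colim G A)"
proof (rule colim_eqI[OF A])
  note colim_map = colim_map[OF A A nt_id_G_maps[OF A]]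
  show "colim_map G A A (nt_id (LL G) A) x \<in> extensional (carrier (colim_grp G A x))"
    if "x \<in> obj (quot G)" for x
    by (rule colim_map(2)[OF that])
  fix e a
  assume e: "e \<in> obj G" and a: "a \<in> carrier (grp A e)"
  have "nt_id (LL G) A e a = a"
    using e a by (simp add: nt_id_def LL_def)
  then show "colim_map G A A (nt_id (LL G) A) (beta_class G e) (colim_can G A e a) =
      nt_id (quot G) (colim G A) (beta_class G e) (colim_can G A e a)"
    using colim_map(3)[OF class_obj_quot[OF e] e refl a] colim_can_closed[OF A e a] class_obj_quot[OF e]
    by (simp add: nt_id_def grp_colim)
qed (simp_all add: colim_map_extensional_obj nt_id_def grp_colim)

lemma colim_map_comp:
  assumes A: "G_module G A" and A': "G_module G A'" and A'': "G_module G A''"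
    and \<eta>: "\<eta> \<in> G_maps G A A'" and \<theta>: "\<theta> \<in> G_maps G A' A''"
  shows "colim_map G A A'' (nt_comp (LL G) A \<eta> \<theta>) =
    nt_comp (quot G) (colim G A) (colim_map G A A' \<eta>) (colim_map G A' A'' \<theta>)"
proof (rule colim_eqI[OF A])
  note colim_map_comp = colim_map[OF A A'' nt_comp_G_maps[OF A \<eta> \<theta>]]
  show "colim_map G A A'' (nt_comp (LL G) A \<eta> \<theta>) x \<in> extensional (carrier (colim_grp G A x))"
    if "x \<in> obj (quot G)" for x
    by (rule colim_map_comp(2)[OF that])
  fix e a
  assume e: "e \<in> obj G" and a: "a \<in> carrier (grp A e)"
  have "nt_comp (LL G) A \<eta> \<theta> e a = \<theta> e (\<eta> e a)"
    using e a by (simp add: nt_comp_def LL_def)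
  then show "colim_map G A A'' (nt_comp (LL G) A \<eta> \<theta>) (beta_class G e) (colim_can G A e a) =
      nt_comp (quot G) (colim G A) (colim_map G A A' \<eta>) (colim_map G A' A'' \<theta>)
        (beta_class G e) (colim_can G A e a)"
    using colim_map_comp(3)[OF class_obj_quot[OF e] e refl a] colim_can_closed[OF A e a] class_obj_quot[OF e]
      colim_map_can[OF A A' \<eta> class_obj_quot[OF e] e refl a]
      colim_map_can[OF A' A'' \<theta> class_obj_quot[OF e] e refl G_maps_closed[OF \<eta> e a]]
    by (simp add: nt_comp_def grp_colim)
qed (simp_all add: colim_map_extensional_obj nt_comp_def grp_colim)

section \<open>The expansion functor\<close>

lemma grp_expand: "grp (expand G B) e = grp B (beta_class G e)"
  by (simp add: expand_def)

lemma act_expand: "act (expand G B) (e, g) = act B (beta_class G g)"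
  by (simp add: expand_def)

lemma expand_map_eq: "e \<in> obj G \<Longrightarrow> expand_map G \<xi> e = \<xi> (beta_class G e)"
  by (simp add: expand_map_def)

text \<open>Composition in \<open>LL G\<close> replaces \<open>g\<close> by a corestriction, which
  lies in the same \<beta>-class. On classes it therefore becomes composition in
  \<open>quot G\<close>, and the functor law of \<open>B\<close> applies.\<close>

lemma expand_module:
  assumes B: "quot_module G B"
  shows "G_module G (expand G B)"
proof -
  have "comm_group (grp (expand G B) e)" if "e \<in> obj G" for e
    using B class_obj_quot[OF that] by (simp add: is_ab_functor_def grp_expand)
  moreover have "act (expand G B) (e, g) \<in> hom (grp (expand G B) e) (grp (expand G B) (tgt G g))"
    if "e \<in> obj G" "g \<in> arr G" "le G (src G g) e" for e g
    unfolding grp_expand act_expand by (rule quot_module_act_hom[OF B that])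
  moreover have "act (expand G B) (e, e) b = b" if "e \<in> obj G" "b \<in> carrier (grp (expand G B) e)" for e b
    using that by (simp add: grp_expand act_expand quot_module_act_obj[OF B])
  moreover have "act (expand G B) (e, cmp G (corestr G g (src G h)) h) b =
      act (expand G B) (tgt G g, h) (act (expand G B) (e, g) b)"
    if eg: "e \<in> obj G" "g \<in> arr G" "le G (src G g) e"
      and h: "h \<in> arr G" "le G (src G h) (tgt G g)" and b: "b \<in> carrier (grp (expand G B) e)" for e g h b
  proof -
    note c = corestr[OF eg(2) src_obj[OF h(1)] h(2)]
    have "beta_class G (src G g) = beta_class G e"
      by (rule class_src_le[OF eg])
    moreover have cg: "beta_class G (corestr G g (src G h)) = beta_class G g"
      by (rule class_eq_le[OF c(1) eg(2) c(3)])
    moreover have "beta_class G (src G (corestr G g (src G h))) = beta_class G (src G g)"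
      using src_quot[OF c(1)] src_quot[OF eg(2)] cg by simp
    ultimately show ?thesis
      using quot_module_act_cmp[OF B c(1) h(1) c(2), of b] b by (simp add: act_expand grp_expand)
  qed
  ultimately show ?thesis
    unfolding is_ab_functor_def LL_def by auto
qed

lemma expand_map_G_maps:
  assumes "\<xi> \<in> quot_maps G B B'"
  shows "expand_map G \<xi> \<in> G_maps G (expand G B) (expand G B')"
proof (rule G_mapsI, unfold grp_expand act_expand)
  show "expand_map G \<xi> \<in> extensional (obj G)"
    by (simp add: expand_map_def)
next
  fix e g b
  assume "e \<in> obj G" "g \<in> arr G" "le G (src G g) e" "b \<in> carrier (grp B (beta_class G e))"
  then show "expand_map G \<xi> (tgt G g) (act B (beta_class G g) b) = act B' (beta_class G g) (expand_map G \<xi> e b)"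
    using quot_maps_act[OF assms] by (simp add: expand_map_eq tgt_obj)
qed (simp_all add: expand_map_eq quot_maps_hom[OF assms] quot_maps_extensional[OF assms] class_obj_quot)

lemma expand_map_id: "expand_map G (nt_id (quot G) B) = nt_id (LL G) (expand G B)"
  by (auto simp: expand_map_def nt_id_def LL_def grp_expand class_obj_quot)

lemma expand_map_comp:
  "expand_map G (nt_comp (quot G) B \<xi> \<zeta>) =
    nt_comp (LL G) (expand G B) (expand_map G \<xi>) (expand_map G \<zeta>)"
  by (auto simp: expand_map_def nt_comp_def LL_def grp_expand class_obj_quot)

section \<open>Transposition: bijectivity and naturality\<close>

lemma adj_transpose_eq:
  "\<lbrakk>e \<in> obj G; a \<in> carrier (grp A e)\<rbrakk>
    \<Longrightarrow> adj_transpose G A \<phi> e a = \<phi> (beta_class G e) (colim_can G A e a)"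
  by (simp add: adj_transpose_def nt_comp_def colim_unit_def expand_map_def LL_def)

lemma adj_transpose_extensional:
  "adj_transpose G A \<phi> \<in> extensional (obj G)"
  "e \<in> obj G \<Longrightarrow> adj_transpose G A \<phi> e \<in> extensional (carrier (grp A e))"
  by (simp_all add: adj_transpose_def nt_comp_def LL_def)

text \<open>By \<open>colim_act_can\<close> the canonical maps carry the action of
  \<open>(e, g)\<close> to that of the class of \<open>g\<close>; naturality of \<phi> at this class
  then gives naturality of the transpose.\<close>

lemma adj_transpose_G_maps:
  assumes A: "G_module G A" and \<phi>: "\<phi> \<in> quot_maps G (colim G A) B"
  shows "adj_transpose G A \<phi> \<in> G_maps G A (expand G B)"
proof (rule G_mapsI)
  show "adj_transpose G A \<phi> e \<in> hom (grp A e) (grp (expand G B) e)" if e: "e \<in> obj G" for e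
  proof -
    interpret comm_group "grp A e" by (rule module_group[OF A e])
    have "\<phi> (beta_class G e) \<circ> colim_can G A e \<in> hom (grp A e) (grp B (beta_class G e))"
      using Group.hom_compose[OF colim_can_hom[OF A e], folded grp_colim, OF quot_maps_hom[OF \<phi> class_obj_quot[OF e]]] .
    then show ?thesis
      using e by (simp add: hom_def Pi_iff adj_transpose_eq grp_expand)
  qed
  show "adj_transpose G A \<phi> (tgt G g) (act A (e, g) a) = act (expand G B) (e, g) (adj_transpose G A \<phi> e a)"
    if "e \<in> obj G" "g \<in> arr G" "le G (src G g) e" "a \<in> carrier (grp A e)" for e g a
  proof -
    have "colim_can G A e a \<in> carrier (grp (colim G A) (beta_class G e))"
      unfolding grp_colim using that by (intro colim_can_closed[OF A])
    from quot_maps_act[OF \<phi> that(1-3) this]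
    show ?thesis
      using that colim_act_can[OF A that(1,4,2,3)] module_act_closed[OF A that]
      by (simp add: adj_transpose_eq act_expand tgt_obj)
  qed
qed (simp_all add: adj_transpose_extensional)

lemma adj_transpose_inj:
  assumes A: "G_module G A"
  shows "inj_on (adj_transpose G A) (quot_maps G (colim G A) B)"
proof (rule inj_onI)
  fix \<phi> \<psi>
  assume \<phi>: "\<phi> \<in> quot_maps G (colim G A) B" and \<psi>: "\<psi> \<in> quot_maps G (colim G A) B"
    and eq: "adj_transpose G A \<phi> = adj_transpose G A \<psi>"
  note ext = quot_maps_extensional[where B = "colim G A", unfolded grp_colim]
  show "\<phi> = \<psi>"
  proof (rule colim_eqI[OF A ext(1)[OF \<phi>] ext(2)[OF \<phi>] ext(1)[OF \<psi>] ext(2)[OF \<psi>]])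
    fix e a
    assume "e \<in> obj G" "a \<in> carrier (grp A e)"
    then show "\<phi> (beta_class G e) (colim_can G A e a) = \<psi> (beta_class G e) (colim_can G A e a)"
      using eq adj_transpose_eq by metis
  qed
qed

text \<open>On each class \<eta> is a cocone into a single group of \<open>B\<close>, which yields
  the components of \<phi>. Naturality of \<phi> at a class is again tested on a canonical element
  with a representative starting below its index.\<close>

lemma adj_transpose_surj:
  assumes A: "G_module G A" and B: "quot_module G B" and \<eta>: "\<eta> \<in> G_maps G A (expand G B)"
  shows "\<exists>\<phi>\<in>quot_maps G (colim G A) B. adj_transpose G A \<phi> = \<eta>"
proof -
  have "\<exists>k\<in>hom (colim_grp G A x) (grp B x).
      \<forall>e\<in>x \<inter> obj G. \<forall>a\<in>carrier (grp A e). k (colim_can G A e a) = \<eta> e a" if x: "x \<in> obj (quot G)" for x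
  proof (rule colim_universal[OF A _ _ _ x])
    show "comm_group (grp B x)"
      using B x by (simp add: is_ab_functor_def)
    show "\<eta> e \<in> hom (grp A e) (grp B x)" if "e \<in> x \<inter> obj G" for e
      using that G_maps_hom[OF \<eta>, of e] obj_quot_mem[OF x, of e] by (auto simp: grp_expand)
    fix e f a
    assume e: "e \<in> x \<inter> obj G" and f: "f \<in> x \<inter> obj G" and fe: "le G f e" and a: "a \<in> carrier (grp A e)"
    \<comment> \<open>Since \<open>e\<close> and \<open>f\<close> have the same class,
      \<open>(e, f)\<close> acts on the expansion as an identity of \<open>quot G\<close>, that is,
      trivially.\<close>
    have "\<eta> e a \<in> carrier (grp B (beta_class G f))"
      using G_maps_closed[OF \<eta>, of e a] e f a obj_quot_mem[OF x] by (auto simp: grp_expand)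
    then show "\<eta> f (act A (e, f) a) = \<eta> e a"
      using G_maps_act_obj[OF \<eta> _ _ fe a] e f by (simp add: act_expand quot_module_act_obj[OF B])
  qed
  then obtain K where K: "\<And>x. x \<in> obj (quot G) \<Longrightarrow> K x \<in> hom (colim_grp G A x) (grp B x)"
    "\<And>x e a. \<lbrakk>x \<in> obj (quot G); e \<in> x \<inter> obj G; a \<in> carrier (grp A e)\<rbrakk> \<Longrightarrow> K x (colim_can G A e a) = \<eta> e a"
    by metis
  define \<phi> where "\<phi> = (\<lambda>x\<in>obj (quot G). restrict (K x) (carrier (colim_grp G A x)))"
  have \<phi>_can: "\<phi> (beta_class G e) (colim_can G A e a) = \<eta> e a"
    if "e \<in> obj G" "a \<in> carrier (grp A e)" for e a
    using K(2)[of "beta_class G e" e a] that class_obj_quot[of e] colim_can_closed[OF A that] class_self[of e]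
    by (simp add: \<phi>_def obj_arr)
  have "\<phi> \<in> quot_maps G (colim G A) B"
  proof (rule quot_mapsI, unfold grp_colim)
    show "\<phi> x \<in> hom (colim_grp G A x) (grp B x)" if x: "x \<in> obj (quot G)" for x
    proof -
      interpret comm_group "colim_grp G A x" by (rule group_colim[OF A])
      show ?thesis
        using K(1)[OF x] x by (simp add: \<phi>_def hom_def Pi_iff)
    qed
    fix p y
    assume p: "p \<in> arr (quot G)" and y: "y \<in> carrier (colim_grp G A (src (quot G) p))"
    obtain e a where e: "e \<in> obj G" "beta_class G e = src (quot G) p" and a: "a \<in> carrier (grp A e)"
        and ya: "y = colim_can G A e a"
      by (rule colim_can_surj[OF A src_quot_obj[OF p] y])
    obtain g where g: "g \<in> arr G" "p = beta_class G g" "le G (src G g) e"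
      by (rule restr_rep[OF p e])
    have "act (colim G A) p y = colim_can G A (tgt G g) (act A (e, g) a)"
      unfolding ya g(2) by (rule colim_act_can[OF A e(1) a g(1,3)])
    moreover have "tgt (quot G) p = beta_class G (tgt G g)"
      unfolding g(2) by (rule tgt_quot[OF g(1)])
    ultimately have "\<phi> (tgt (quot G) p) (act (colim G A) p y) = \<eta> (tgt G g) (act A (e, g) a)"
      by (simp add: \<phi>_can[OF tgt_obj[OF g(1)] module_act_closed[OF A e(1) g(1,3) a]])
    also have "\<dots> = act B p (\<eta> e a)"
      using G_maps_act[OF \<eta> e(1) g(1,3) a] by (simp add: act_expand g(2))
    also have "\<eta> e a = \<phi> (src (quot G) p) y"
      unfolding ya e(2)[symmetric] by (rule \<phi>_can[OF e(1) a, symmetric])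
    finally show "\<phi> (tgt (quot G) p) (act (colim G A) p y) = act B p (\<phi> (src (quot G) p) y)" .
  qed (simp_all add: \<phi>_def)
  moreover have "adj_transpose G A \<phi> = \<eta>"
  proof (rule extensionalityI[OF adj_transpose_extensional(1) G_maps_extensional(1)[OF \<eta>]])
    fix e
    assume e: "e \<in> obj G"
    show "adj_transpose G A \<phi> e = \<eta> e"
      by (rule extensionalityI[OF adj_transpose_extensional(2)[OF e] G_maps_extensional(2)[OF \<eta> e]])
        (simp add: adj_transpose_eq[OF e] \<phi>_can[OF e])
  qed
  ultimately show ?thesis
    by blast
qed

lemma adj_transpose_bij:
  assumes "G_module G A" "quot_module G B"
  shows "bij_betw (adj_transpose G A) (quot_maps G (colim G A) B) (G_maps G A (expand G B))"
proof (rule bij_betw_imageI[OF adj_transpose_inj[OF assms(1)]])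
  show "adj_transpose G A ` quot_maps G (colim G A) B = G_maps G A (expand G B)"
  proof
    show "adj_transpose G A ` quot_maps G (colim G A) B \<subseteq> G_maps G A (expand G B)"
      using adj_transpose_G_maps[OF assms(1)] by blast
    show "G_maps G A (expand G B) \<subseteq> adj_transpose G A ` quot_maps G (colim G A) B"
      using adj_transpose_surj[OF assms] by blast
  qed
qed

text \<open>Naturality in both variables is treated at once, with \<eta> before and \<xi> after. As
  \<open>colim_map\<close> commutes with the canonical maps, both sides send \<open>a\<close> to the
  image under \<phi> and then \<xi> of the canonical element of \<open>\<eta> e a\<close>.\<close>

lemma adj_transpose_natural:
  assumes A': "G_module G A'" and A: "G_module G A" and \<eta>: "\<eta> \<in> G_maps G A' A"
  shows "adj_transpose G A' (nt_comp (quot G) (colim G A')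
      (colim_map G A' A \<eta>) (nt_comp (quot G) (colim G A) \<phi> \<xi>)) =
    nt_comp (LL G) A' \<eta> (nt_comp (LL G) A (adj_transpose G A \<phi>) (expand_map G \<xi>))"
    (is "?l = ?r")
proof (rule extensionalityI[OF adj_transpose_extensional(1)])
  show "?r \<in> extensional (obj G)"
    by (simp add: nt_comp_def LL_def)
  fix e
  assume e: "e \<in> obj G"
  show "?l e = ?r e"
  proof (rule extensionalityI[OF adj_transpose_extensional(2)[OF e]])
    show "?r e \<in> extensional (carrier (grp A' e))"
      using e by (simp add: nt_comp_def LL_def)
    fix a
    assume a: "a \<in> carrier (grp A' e)"
    have \<eta>a: "\<eta> e a \<in> carrier (grp A e)"
      by (rule G_maps_closed[OF \<eta> e a])
    have x: "beta_class G e \<in> obj (quot G)"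
      by (rule class_obj_quot[OF e])
    have "?l e a = \<xi> (beta_class G e) (\<phi> (beta_class G e) (colim_can G A e (\<eta> e a)))"
      using colim_can_closed[OF A' e a] colim_can_closed[OF A e \<eta>a] x
      by (simp add: adj_transpose_eq[OF e a] nt_comp_def grp_colim colim_map_can[OF A' A \<eta> x e refl a])
    also have "\<dots> = ?r e a"
      using e a \<eta>a by (simp add: nt_comp_def LL_def adj_transpose_eq expand_map_eq)
    finally show "?l e a = ?r e a" .
  qed
qed

end

theorem theorem4p4:
  fixes G :: "'g ord_gpd"
  assumes "principally_directed_ordered_groupoid G"
  shows
    \<comment> \<open>\<open>colim\<close> is a functor from \<open>G\<close>-modules to \<open>G/\<beta>\<close>-modules\<close>
    "(\<forall>A :: ('g, 'a) gmodule. G_module G A \<longrightarrow>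
        quot_module G (colim G A) \<and>
        colim_map G A A (nt_id (LL G) A) = nt_id (quot G) (colim G A)) \<and>
     (\<forall>(A :: ('g, 'a) gmodule) (A' :: ('g, 'a1) gmodule).
        \<forall>\<eta>\<in>G_maps G A A'. G_module G A \<and> G_module G A' \<longrightarrow>
          colim_map G A A' \<eta> \<in> quot_maps G (colim G A) (colim G A')) \<and>
     (\<forall>(A :: ('g, 'a) gmodule) (A' :: ('g, 'a1) gmodule) (A'' :: ('g, 'a2) gmodule).
        \<forall>\<eta>\<in>G_maps G A A'. \<forall>\<theta>\<in>G_maps G A' A''.
          G_module G A \<and> G_module G A' \<and> G_module G A'' \<longrightarrow>
          colim_map G A A'' (nt_comp (LL G) A \<eta> \<theta>) =
            nt_comp (quot G) (colim G A) (colim_map G A A' \<eta>) (colim_map G A' A'' \<theta>)) \<and>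
     \<comment> \<open>expansion is a functor from \<open>G/\<beta>\<close>-modules to \<open>G\<close>-modules\<close>
     (\<forall>B :: ('g, 'b) qmodule. quot_module G B \<longrightarrow>
        G_module G (expand G B) \<and>
        expand_map G (nt_id (quot G) B) = nt_id (LL G) (expand G B)) \<and>
     (\<forall>(B :: ('g, 'b) qmodule) (B' :: ('g, 'b1) qmodule).
        \<forall>\<xi>\<in>quot_maps G B B'. quot_module G B \<and> quot_module G B' \<longrightarrow>
          expand_map G \<xi> \<in> G_maps G (expand G B) (expand G B')) \<and>
     (\<forall>(B :: ('g, 'b) qmodule) (B' :: ('g, 'b1) qmodule) (B'' :: ('g, 'b2) qmodule).
        \<forall>\<xi>\<in>quot_maps G B B'. \<forall>\<zeta>\<in>quot_maps G B' B''.
          quot_module G B \<and> quot_module G B' \<and> quot_module G B'' \<longrightarrow>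
          expand_map G (nt_comp (quot G) B \<xi> \<zeta>) =
            nt_comp (LL G) (expand G B) (expand_map G \<xi>) (expand_map G \<zeta>)) \<and>
     \<comment> \<open>transposition is a bijection of Hom-sets\<close>
     (\<forall>(A :: ('g, 'a) gmodule) (B :: ('g, 'b) qmodule).
        G_module G A \<and> quot_module G B \<longrightarrow>
          bij_betw (adj_transpose G A) (quot_maps G (colim G A) B) (G_maps G A (expand G B))) \<and>
     \<comment> \<open>which is natural in both variables\<close>
     (\<forall>(A' :: ('g, 'a1) gmodule) (A :: ('g, 'a) gmodule)
        (B :: ('g, 'b) qmodule) (B' :: ('g, 'b1) qmodule).
        \<forall>\<eta>\<in>G_maps G A' A. \<forall>\<phi>\<in>quot_maps G (colim G A) B. \<forall>\<xi>\<in>quot_maps G B B'.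
          G_module G A' \<and> G_module G A \<and> quot_module G B \<and> quot_module G B' \<longrightarrow>
          adj_transpose G A' (nt_comp (quot G) (colim G A')
              (colim_map G A' A \<eta>) (nt_comp (quot G) (colim G A) \<phi> \<xi>)) =
            nt_comp (LL G) A' \<eta> (nt_comp (LL G) A (adj_transpose G A \<phi>) (expand_map G \<xi>)))"
proof -
  interpret principally_directed_ordered_groupoid G by (rule assms)
  show ?thesis
    by (intro conjI allI ballI impI; (elim conjE)?;
        (rule colim_module colim_map_id colim_map_quot_maps colim_map_comp expand_module expand_map_id
          expand_map_G_maps expand_map_comp adj_transpose_bij adj_transpose_natural; assumption))
qed

end
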